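(* Suppose that: (1) for all $t=0,\dots,T-1$, $\boldsymbol\Gamma_t$ is a closed convex valued set-valued mapping; (2) for all $t=0,\dots,T-1$, $f_t$ and $L_t$ are continuously differentiable with respect to their first two arguments (state and control); $K$ is continuously differentiable; $L_t$ and $f_t$ are normal integrands; the derivatives of $f_t$, $L_t$ and $K$ are square integrable (in the sense given in the context); (3) $\mathcal G_t\subset\mathcal F_t$ for all $t=0,\dots,T$, and $\boldsymbol\Gamma_t$ is $\mathcal G_t$-measurable for all $t=0,\dots,T-1$. Let the two random processes $(\mathbf x_t)_{t=0,\dots,T}\in\mathcal X$ and $(\mathbf u_t)_{t=0,\dots,T-1}\in\mathcal U$ be a solution of the problem $$\min_{(\mathbf u,\mathbf x)\in\mathcal U\times\mathcal X}\ \mathbb E\Big(\sum_{t=0}^{T-1}L_t(\mathbf x_t,\mathbf u_t,\mathbf w_{t+1})+K(\mathbf x_T)\Big)$$ subject to $\mathbf x_0=\mathbf w_0$, $\mathbf x_{t+1}=f_t(\mathbf x_t,\mathbf u_t,\mathbf w_{t+1})$ $\mathbb P$-a.s. and $\mathbf u_t\in\mathcal U^{\rm as}_t\cap\mathcal U^{\rm me}_t$ for all $t=0,\dots,T-1$. Then there exists a random process $(\boldsymbol\lambda_t)_{t=0,\dots,T}\in\mathcal X$ such that, for all $t=0,\dots,T-1$, \begin{align*} &\mathbf x_0=\mathbf w_0,\qquad \mathbf x_{t+1}=f_t(\mathbf x_t,\mathbf u_t,\mathbf w_{t+1}),\\ &\boldsymbol\lambda_T=K'^\top(\mathbf x_T),\qquad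 \boldsymbol\lambda_t=(L_t)'^\top_x(\mathbf x_t,\mathbf u_t,\mathbf w_{t+1})+(f_t)'^\top_x(\mathbf x_t,\mathbf u_t,\mathbf w_{t+1})\boldsymbol\lambda_{t+1},\\ &\mathbb E\big((L_t)'_u(\mathbf x_t,\mathbf u_t,\mathbf w_{t+1})+\boldsymbol\lambda_{t+1}^\top(f_t)'_u(\mathbf x_t,\mathbf u_t,\mathbf w_{t+1})\,\big|\,\mathcal G_t\big)\in-\partial\chi_{\mathcal U^{\rm as}_t}(\mathbf u_t). \end{align*}
   Context: $(\Omega,\mathcal A,\mathbb P)$ is a probability space and $T\ge 1$ an integer. $\mathbb W_t=\mathbb R^{d_{w_t}}$, $\mathbb X_t=\mathbb R^{d_{x_t}}$, $\mathbb Y_t=\mathbb R^{d_{y_t}}$ ($t=0,\dots,T$) and $\mathbb U_t=\mathbb R^{d_{u_t}}$ ($t=0,\dots,T-1$) are the noise, state, observation and control spaces. $\mathcal X_t$ is the set of $\mathbb X_t$-valued random variables on $(\Omega,\mathcal A,\mathbb P)$ and $\mathcal X=\mathcal X_0\times\dots\times\mathcal X_T$; $\mathcal U_t=L^2(\Omega,\mathcal A,\mathbb P;\mathbb U_t)$ and $\mathcal U=\mathcal U_0\times\dots\times\mathcal U_{T-1}$. The noise process is $\mathbf w=(\mathbf w_0,\dots,\mathbf w_T)$ with $\mathbf w_t$ a $\mathbb W_t$-valued random variable (and $\mathbb W_0=\mathbb X_0$). Dynamics: $f_t:\mathbb X_t\times\mathbb U_t\times\mathbb W_{t+1}\to\mathbb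 X_{t+1}$; costs: $L_t:\mathbb X_t\times\mathbb U_t\times\mathbb W_{t+1}\to\mathbb R$ and $K:\mathbb X_T\to\mathbb R$. Observations: $\mathbf y_t=\widetilde h_t(\mathbf w_0,\dots,\mathbf w_T)$ $\mathbb P$-a.s. with $\widetilde h_t:\mathbb W_0\times\dots\times\mathbb W_T\to\mathbb Y_t$ measurable; $\mathcal G_t=\sigma(\mathbf y_t)$; $\mathcal F_t=\sigma(\mathbf w_0,\dots,\mathbf w_t)$. $\boldsymbol\Gamma_t:\Omega\rightrightarrows\mathbb U_t$ are set-valued mappings, and $$\mathcal U^{\rm as}_t=\{\mathbf u_t\in\mathcal U_t:\mathbf u_t(\omega)\in\boldsymbol\Gamma_t(\omega)\ \mathbb P\text{-a.s.}\},\quad \mathcal U^{\rm me}_t=\{\mathbf u_t\in\mathcal U_t:\mathbf u_t\text{ is }\mathcal G_t\text{-measurable}\}.$$ Normal integrands are in the sense of Rockafellar–Wets, Definition 14.27 ((state, control) being the decision argument, the noise the measurable parameter; componentwise for $f_t$). Derivatives with respect to $x$ and $u$ are row vectors/Jacobian matrices, $\top$ denotes transpose; row vectors are identified with their transposes via the inner product. For a convex subset $C$ of a Hilbert space and $u\in C$, $\chi_C$ is the indicator function ($0$ on $C$, $+\infty$ elsewhere) and $\partial\chi_C(u)=\{r:\langle r,v-u\rangle\le0\ \forall v\in C\}$ (here in $\mathcal U_t$). Meaning of "the derivatives are square integrable": the assumption permits all integration and differentiation operations. Namely, writing $j(u,w)$ for the total cost $\sum_t L_t(x_t,u_t,w_{t+1})+K(x_T)$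 as a function of $(u,w)$ after elimination of the state by the dynamics, $J(\mathbf u)=\mathbb E(j(\mathbf u,\mathbf w))$ is finite on $\mathcal U$, and for every $\mathbf u\in\mathcal U$, along the corresponding state trajectory, the derivatives in $x$ and $u$ of $f_t,L_t,K$, the co-states defined by $\boldsymbol\lambda_T=K'^\top(\mathbf x_T)$, $\boldsymbol\lambda_t=(L_t)'^\top_x+(f_t)'^\top_x\boldsymbol\lambda_{t+1}$, and the derivative $j'_u(\mathbf u,\mathbf w)$ are square integrable. *)

theory Defs
  imports "HOL-Probability.Probability"
begin

section \<open>Euclidean spaces whose dimension depends on the time step\<close>

text \<open>
  The spaces \<open>\<real>\<^sup>d\<close> have a dimension \<open>d\<close> that varies with time, whereas the dimension of \<open>real ^ 'n\<close>
  is fixed by its type. We therefore realise \<open>\<real>\<^sup>d\<close> as the set of vectors of \<open>real ^ 'n\<close> supported by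
  an index set \<open>I\<close> with \<open>card I = d\<close>. As only finitely many spaces occur and the index type is
  arbitrary, every choice of the dimensions (including \<open>0\<close>) is covered.
\<close>

definition coord_space :: "'n::finite set \<Rightarrow> (real ^ 'n) set" where
  "coord_space I = {v. \<forall>i. i \<notin> I \<longrightarrow> v $ i = 0}"

abbreviation coord_borel :: "'n::finite set \<Rightarrow> (real ^ 'n) measure" where
  "coord_borel I \<equiv> restrict_space borel (coord_space I)"

lemma subspace_coord_space: "subspace (coord_space I)"
  by (auto simp: coord_space_def subspace_def)

lemma dim_coord_space: "dim (coord_space I) = card I"
  using dim_substandard_cart[of I, where 'a = real]
  by (simp add: coord_space_def dim_vec_eq)


section \<open>Square integrable random variables and conditional expectation\<close>

text \<open>
  Elements of \<open>L\<^sup>2\<close> are represented by functions; membership in the sets \<open>L2\<close>, \<open>controls_as\<close>,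
  \<open>controls_me\<close> and \<open>subdiff_indicator\<close> does not distinguish functions (with values in the space
  concerned) that agree almost surely.
\<close>

definition L2 :: "'a measure \<Rightarrow> 'n::finite set \<Rightarrow> ('a \<Rightarrow> real ^ 'n) set" where
  "L2 M I = {u \<in> M \<rightarrow>\<^sub>M coord_borel I. integrable M (\<lambda>\<omega>. (norm (u \<omega>))\<^sup>2)}"

definition vec_cond_exp ::
  "'a measure \<Rightarrow> 'a measure \<Rightarrow> 'n::finite set \<Rightarrow> ('a \<Rightarrow> real ^ 'n) \<Rightarrow> 'a \<Rightarrow> real ^ 'n" where
  "vec_cond_exp M G I g =
     (\<lambda>\<omega>. \<chi> i. if i \<in> I then real_cond_exp M G (\<lambda>\<omega>'. g \<omega>' $ i) \<omega> else 0)"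

text \<open>
  The subdifferential at \<open>u\<close> of the indicator function of a convex \<open>C\<close> with \<open>u \<in> C\<close>, in the Hilbert
  space \<open>L2 M I\<close>.
\<close>

definition subdiff_indicator ::
  "'a measure \<Rightarrow> 'n::finite set \<Rightarrow> ('a \<Rightarrow> real ^ 'n) set \<Rightarrow> ('a \<Rightarrow> real ^ 'n) \<Rightarrow> ('a \<Rightarrow> real ^ 'n) set"
where
  "subdiff_indicator M I C u =
     {r \<in> L2 M I. \<forall>v\<in>C. (\<integral>\<omega>. inner (r \<omega>) (v \<omega> - u \<omega>) \<partial>M) \<le> 0}"

definition noise_algebra :: "'a measure \<Rightarrow> (nat \<Rightarrow> 'a \<Rightarrow> real ^ 'n::finite) \<Rightarrow> nat \<Rightarrow> 'a measure" where
  "noise_algebra M w t = sigma (space M) (\<Union>s\<in>{..t}. sets (vimage_algebra (space M) (w s) borel))"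

definition obs_algebra :: "'a measure \<Rightarrow> (nat \<Rightarrow> 'a \<Rightarrow> real ^ 'k::finite) \<Rightarrow> nat \<Rightarrow> 'a measure" where
  "obs_algebra M y t = vimage_algebra (space M) (y t) borel"


section \<open>Measurable set-valued mappings and normal integrands\<close>

text \<open>Definitions 14.1 and 14.27 of Rockafellar and Wets, Variational Analysis. The integrand \<open>\<phi>\<close> is
  real-valued; its parameter ranges over \<open>N\<close> and its decision argument over \<open>V\<close>.\<close>

definition measurable_setmap :: "'p measure \<Rightarrow> ('p \<Rightarrow> 'v::topological_space set) \<Rightarrow> bool" where
  "measurable_setmap N \<Gamma> \<longleftrightarrow> (\<forall>S. open S \<longrightarrow> {p \<in> space N. \<Gamma> p \<inter> S \<noteq> {}} \<in> sets N)"

definition normal_integrand ::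
  "'p measure \<Rightarrow> 'v::euclidean_space set \<Rightarrow> ('p \<Rightarrow> 'v \<Rightarrow> real) \<Rightarrow> bool" where
  "normal_integrand N V \<phi> \<longleftrightarrow>
     (\<forall>p\<in>space N. closed (epigraph V (\<phi> p))) \<and> measurable_setmap N (\<lambda>p. epigraph V (\<phi> p))"


section \<open>Derivatives along a subspace\<close>

definition C1_on ::
  "'v::real_normed_vector set \<Rightarrow> ('v \<Rightarrow> 'b::real_normed_vector) \<Rightarrow> bool" where
  "C1_on V \<phi> \<longleftrightarrow>
     (\<exists>D :: 'v \<Rightarrow> 'v \<Rightarrow>\<^sub>L 'b.
        (\<forall>x\<in>V. (\<phi> has_derivative blinfun_apply (D x)) (at x within V)) \<and> continuous_on V D)"

text \<open>
  \<open>deriv_T V \<phi> x \<mu>\<close> is the transposed Jacobian of \<open>\<phi>\<close> at \<open>x \<in> V\<close>, taken along the subspace \<open>V\<close>,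
  applied to \<open>\<mu>\<close>; for real-valued \<open>\<phi>\<close>, \<open>deriv_T V \<phi> x 1\<close> is the transposed derivative (gradient).
  The linear map chosen by \<open>frechet_derivative\<close> is arbitrary off \<open>V\<close>, but unique on \<open>V\<close>.
\<close>

definition deriv_T ::
  "'v::euclidean_space set \<Rightarrow> ('v \<Rightarrow> 'b::real_inner) \<Rightarrow> 'v \<Rightarrow> 'b \<Rightarrow> 'v" where
  "deriv_T V \<phi> x \<mu> =
     (THE g. g \<in> V \<and> (\<forall>h\<in>V. inner g h = inner \<mu> (frechet_derivative \<phi> (at x within V) h)))"

lemma deriv_T_works:
  fixes V :: "'v::euclidean_space set" and \<phi> :: "'v \<Rightarrow> 'b::real_inner"
  assumes V: "subspace V" and x: "x \<in> V"
    and D: "(\<phi> has_derivative D) (at x within V)"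
  shows "deriv_T V \<phi> x \<mu> \<in> V"
    and "\<And>h. h \<in> V \<Longrightarrow> inner (deriv_T V \<phi> x \<mu>) h = inner \<mu> (D h)"
proof -
  let ?F = "frechet_derivative \<phi> (at x within V)"
  have F: "(\<phi> has_derivative ?F) (at x within V)"
    using D frechet_derivative_works by (blast intro: differentiableI)
  have line: "((\<lambda>s::real. \<phi> (x + s *\<^sub>R h)) has_derivative (\<lambda>s. E (s *\<^sub>R h))) (at 0)"
    if "h \<in> V" and E: "(\<phi> has_derivative E) (at x within V)" for h E
  proof -
    have "((\<lambda>s::real. x + s *\<^sub>R h) has_derivative (\<lambda>s. s *\<^sub>R h)) (at 0)"
      by (auto intro!: derivative_eq_intros)
    moreover have "range (\<lambda>s::real. x + s *\<^sub>R h) \<subseteq> V"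
      using V x that(1) by (auto simp: subspace_def)
    then have "(\<phi> has_derivative E) (at (x + 0 *\<^sub>R h) within range (\<lambda>s::real. x + s *\<^sub>R h))"
      using has_derivative_subset[OF E] by simp
    ultimately show ?thesis
      using diff_chain_within[of "\<lambda>s::real. x + s *\<^sub>R h" "\<lambda>s. s *\<^sub>R h" 0 UNIV \<phi> E]
      by (simp add: o_def)
  qed
  have eq: "?F h = D h" if "h \<in> V" for h
    using fun_cong[OF has_derivative_unique[OF line[OF that F] line[OF that D]], of 1] by simp
  have lin: "linear D"
    using D by (rule has_derivative_linear)
  define g0 where "g0 = (\<Sum>b\<in>Basis. inner \<mu> (D b) *\<^sub>R b)"
  have g0: "inner g0 h = inner \<mu> (D h)" for h
  proof -
    have "D h = D (\<Sum>b\<in>Basis. inner h b *\<^sub>R b)"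
      by (simp only: euclidean_representation)
    also have "\<dots> = (\<Sum>b\<in>Basis. inner h b *\<^sub>R D b)"
      by (simp only: linear_sum[OF lin] linear_cmul[OF lin])
    finally have "inner \<mu> (D h) = (\<Sum>b\<in>Basis. inner h b * inner \<mu> (D b))"
      by (simp only: inner_sum_right inner_scaleR_right)
    then show ?thesis
      by (simp only: g0_def inner_sum_left inner_scaleR_left inner_commute[of h] mult.commute)
  qed
  obtain g r where g: "g \<in> span V" "\<And>h. h \<in> span V \<Longrightarrow> orthogonal r h" "g0 = g + r"
    using orthogonal_subspace_decomp_exists[of V g0] by blast
  have sp: "span V = V"
    using V by (simp only: span_eq_iff)
  have gV: "g \<in> V"
    using g(1) sp by simp
  have gh: "inner g h = inner \<mu> (D h)" if "h \<in> V" for h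
    using g(2)[of h] g(3) that g0[of h] by (simp add: sp orthogonal_def inner_add_left)
  have uniq: "g' = g" if g': "g' \<in> V" "\<forall>h\<in>V. inner g' h = inner \<mu> (?F h)" for g'
  proof -
    have m: "g' - g \<in> V"
      using V g'(1) gV by (rule subspace_diff)
    have "inner g' (g' - g) = inner g (g' - g)"
      using g'(2) m gh[OF m] eq[OF m] by simp
    then have "inner (g' - g) (g' - g) = 0"
      by (simp only: inner_diff_left)
    then show ?thesis
      by simp
  qed
  have "deriv_T V \<phi> x \<mu> = g"
    unfolding deriv_T_def
  proof (rule the_equality)
    show "g \<in> V \<and> (\<forall>h\<in>V. inner g h = inner \<mu> (?F h))"
      using gV gh eq by metis
  qed (use uniq in blast)
  then show "deriv_T V \<phi> x \<mu> \<in> V"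
    and "\<And>h. h \<in> V \<Longrightarrow> inner (deriv_T V \<phi> x \<mu>) h = inner \<mu> (D h)"
    using gV gh by simp_all
qed

definition deriv_x_T ::
  "'n::finite set \<Rightarrow> (real ^ 'n \<Rightarrow> real ^ 'm \<Rightarrow> 'w \<Rightarrow> 'b::real_inner)
    \<Rightarrow> real ^ 'n \<Rightarrow> real ^ 'm::finite \<Rightarrow> 'w \<Rightarrow> 'b \<Rightarrow> real ^ 'n" where
  "deriv_x_T I \<phi> x u w \<mu> = deriv_T (coord_space I) (\<lambda>z. \<phi> z u w) x \<mu>"

definition deriv_u_T ::
  "'m::finite set \<Rightarrow> (real ^ 'n \<Rightarrow> real ^ 'm \<Rightarrow> 'w \<Rightarrow> 'b::real_inner)
    \<Rightarrow> real ^ 'n::finite \<Rightarrow> real ^ 'm \<Rightarrow> 'w \<Rightarrow> 'b \<Rightarrow> real ^ 'm" where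
  "deriv_u_T I \<phi> x u w \<mu> = deriv_T (coord_space I) (\<lambda>v. \<phi> x v w) u \<mu>"


section \<open>The control problem\<close>

type_synonym ('n, 'm, 'b) stage_map = "nat \<Rightarrow> real ^ 'n \<Rightarrow> real ^ 'm \<Rightarrow> real ^ 'n \<Rightarrow> 'b"

primrec state ::
  "('n::finite, 'm::finite, real ^ 'n) stage_map
    \<Rightarrow> (nat \<Rightarrow> real ^ 'm) \<Rightarrow> (nat \<Rightarrow> real ^ 'n) \<Rightarrow> nat \<Rightarrow> real ^ 'n" where
  "state f u w 0 = w 0"
| "state f u w (Suc t) = f t (state f u w t) (u t) (w (Suc t))"

definition path_cost ::
  "nat \<Rightarrow> ('n::finite, 'm::finite, real) stage_map \<Rightarrow> (real ^ 'n \<Rightarrow> real)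
    \<Rightarrow> (nat \<Rightarrow> real ^ 'n) \<Rightarrow> (nat \<Rightarrow> real ^ 'm) \<Rightarrow> (nat \<Rightarrow> real ^ 'n) \<Rightarrow> real" where
  "path_cost T L K x u w = (\<Sum>t<T. L t (x t) (u t) (w (Suc t))) + K (x T)"

text \<open>The cost \<open>j(u, w)\<close> after elimination of the state.\<close>

definition reduced_cost ::
  "nat \<Rightarrow> ('n::finite, 'm::finite, real ^ 'n) stage_map \<Rightarrow> ('n, 'm, real) stage_map
    \<Rightarrow> (real ^ 'n \<Rightarrow> real) \<Rightarrow> (nat \<Rightarrow> real ^ 'm) \<Rightarrow> (nat \<Rightarrow> real ^ 'n) \<Rightarrow> real" where
  "reduced_cost T f L K u w = path_cost T L K (state f u w) u w"

text \<open>The co-state at time \<open>T - k\<close>, by recursion on \<open>k\<close>.\<close>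

primrec costate_back ::
  "nat \<Rightarrow> (nat \<Rightarrow> 'n::finite set) \<Rightarrow> ('n, 'm::finite, real ^ 'n) stage_map
    \<Rightarrow> ('n, 'm, real) stage_map \<Rightarrow> (real ^ 'n \<Rightarrow> real)
    \<Rightarrow> (nat \<Rightarrow> real ^ 'm) \<Rightarrow> (nat \<Rightarrow> real ^ 'n) \<Rightarrow> nat \<Rightarrow> real ^ 'n" where
  "costate_back T IX f L K u w 0 = deriv_T (coord_space (IX T)) K (state f u w T) 1"
| "costate_back T IX f L K u w (Suc k) =
     (let t = T - Suc k; x = state f u w t in
        deriv_x_T (IX t) (L t) x (u t) (w (Suc t)) 1
        + deriv_x_T (IX t) (f t) x (u t) (w (Suc t)) (costate_back T IX f L K u w k))"

definition costate ::
  "nat \<Rightarrow> (nat \<Rightarrow> 'n::finite set) \<Rightarrow> ('n, 'm::finite, real ^ 'n) stage_map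
    \<Rightarrow> ('n, 'm, real) stage_map \<Rightarrow> (real ^ 'n \<Rightarrow> real)
    \<Rightarrow> (nat \<Rightarrow> real ^ 'm) \<Rightarrow> (nat \<Rightarrow> real ^ 'n) \<Rightarrow> nat \<Rightarrow> real ^ 'n" where
  "costate T IX f L K u w t = costate_back T IX f L K u w (T - t)"

text \<open>
  A Jacobian matrix is square integrable if each of its rows is; the row with index \<open>i\<close> is
  the transposed Jacobian applied to \<open>axis i 1\<close>. The derivative of the reduced cost in
  \<open>u = (u\<^sub>0, \<dots>, u\<^bsub>T-1\<^esub>)\<close> is given by its blocks, the partial derivatives in the \<open>u\<^sub>t\<close>.
\<close>

definition square_integrable_derivatives ::
  "'a measure \<Rightarrow> nat \<Rightarrow> (nat \<Rightarrow> 'n::finite set) \<Rightarrow> (nat \<Rightarrow> 'm::finite set)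
    \<Rightarrow> (nat \<Rightarrow> 'a \<Rightarrow> real ^ 'n) \<Rightarrow> ('n, 'm, real ^ 'n) stage_map
    \<Rightarrow> ('n, 'm, real) stage_map \<Rightarrow> (real ^ 'n \<Rightarrow> real) \<Rightarrow> bool" where
  "square_integrable_derivatives M T IX IU w f L K \<longleftrightarrow>
     (\<forall>u. (\<forall>t<T. u t \<in> L2 M (IU t)) \<longrightarrow>
       (let un = (\<lambda>\<omega> t. u t \<omega>); wn = (\<lambda>\<omega> t. w t \<omega>); x = (\<lambda>\<omega>. state f (un \<omega>) (wn \<omega>)) in
          integrable M (\<lambda>\<omega>. reduced_cost T f L K (un \<omega>) (wn \<omega>)) \<and>
          (\<forall>t<T.
             (\<forall>i\<in>IX (Suc t).
                (\<lambda>\<omega>. deriv_x_T (IX t) (f t) (x \<omega> t) (u t \<omega>) (w (Suc t) \<omega>) (axis i 1)) \<in> L2 M (IX t) \<and>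
                (\<lambda>\<omega>. deriv_u_T (IU t) (f t) (x \<omega> t) (u t \<omega>) (w (Suc t) \<omega>) (axis i 1)) \<in> L2 M (IU t)) \<and>
             (\<lambda>\<omega>. deriv_x_T (IX t) (L t) (x \<omega> t) (u t \<omega>) (w (Suc t) \<omega>) 1) \<in> L2 M (IX t) \<and>
             (\<lambda>\<omega>. deriv_u_T (IU t) (L t) (x \<omega> t) (u t \<omega>) (w (Suc t) \<omega>) 1) \<in> L2 M (IU t)) \<and>
          (\<lambda>\<omega>. deriv_T (coord_space (IX T)) K (x \<omega> T) 1) \<in> L2 M (IX T) \<and>
          (\<forall>t\<le>T. (\<lambda>\<omega>. costate T IX f L K (un \<omega>) (wn \<omega>) t) \<in> L2 M (IX t)) \<and>
          (\<forall>t<T. (\<lambda>\<omega>. deriv_T (coord_space (IU t))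
                        (\<lambda>v. reduced_cost T f L K ((un \<omega>)(t := v)) (wn \<omega>)) (u t \<omega>) 1)
                   \<in> L2 M (IU t))))"

definition controls_as ::
  "'a measure \<Rightarrow> 'm::finite set \<Rightarrow> ('a \<Rightarrow> (real ^ 'm) set) \<Rightarrow> ('a \<Rightarrow> real ^ 'm) set" where
  "controls_as M I \<Gamma> = {u \<in> L2 M I. AE \<omega> in M. u \<omega> \<in> \<Gamma> \<omega>}"

text \<open>An element of \<open>L\<^sup>2\<close> is measurable with respect to \<open>G\<close> if it has a \<open>G\<close>-measurable representative.\<close>

definition controls_me ::
  "'a measure \<Rightarrow> 'm::finite set \<Rightarrow> 'a measure \<Rightarrow> ('a \<Rightarrow> real ^ 'm) set" where
  "controls_me M I G = {u \<in> L2 M I. \<exists>v\<in>G \<rightarrow>\<^sub>M coord_borel I. AE \<omega> in M. u \<omega> = v \<omega>}"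

definition admissible ::
  "'a measure \<Rightarrow> nat \<Rightarrow> (nat \<Rightarrow> 'n::finite set) \<Rightarrow> (nat \<Rightarrow> 'm::finite set)
    \<Rightarrow> (nat \<Rightarrow> 'a \<Rightarrow> real ^ 'n) \<Rightarrow> ('n, 'm, real ^ 'n) stage_map
    \<Rightarrow> (nat \<Rightarrow> 'a measure) \<Rightarrow> (nat \<Rightarrow> 'a \<Rightarrow> (real ^ 'm) set)
    \<Rightarrow> (nat \<Rightarrow> 'a \<Rightarrow> real ^ 'm) \<Rightarrow> (nat \<Rightarrow> 'a \<Rightarrow> real ^ 'n) \<Rightarrow> bool" where
  "admissible M T IX IU w f G \<Gamma> u x \<longleftrightarrow>
     (\<forall>t\<le>T. x t \<in> M \<rightarrow>\<^sub>M coord_borel (IX t)) \<and>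
     (AE \<omega> in M. x 0 \<omega> = w 0 \<omega>) \<and>
     (\<forall>t<T. (AE \<omega> in M. x (Suc t) \<omega> = f t (x t \<omega>) (u t \<omega>) (w (Suc t) \<omega>)) \<and>
            u t \<in> controls_as M (IU t) (\<Gamma> t) \<inter> controls_me M (IU t) (G t))"

definition expected_cost ::
  "'a measure \<Rightarrow> nat \<Rightarrow> (nat \<Rightarrow> 'a \<Rightarrow> real ^ 'n::finite) \<Rightarrow> ('n, 'm::finite, real) stage_map
    \<Rightarrow> (real ^ 'n \<Rightarrow> real) \<Rightarrow> (nat \<Rightarrow> 'a \<Rightarrow> real ^ 'm) \<Rightarrow> (nat \<Rightarrow> 'a \<Rightarrow> real ^ 'n) \<Rightarrow> real" where
  "expected_cost M T w L K u x =
     (\<integral>\<omega>. path_cost T L K (\<lambda>t. x t \<omega>) (\<lambda>t. u t \<omega>) (\<lambda>t. w t \<omega>) \<partial>M)"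

definition is_solution ::
  "'a measure \<Rightarrow> nat \<Rightarrow> (nat \<Rightarrow> 'n::finite set) \<Rightarrow> (nat \<Rightarrow> 'm::finite set)
    \<Rightarrow> (nat \<Rightarrow> 'a \<Rightarrow> real ^ 'n) \<Rightarrow> ('n, 'm, real ^ 'n) stage_map
    \<Rightarrow> ('n, 'm, real) stage_map \<Rightarrow> (real ^ 'n \<Rightarrow> real)
    \<Rightarrow> (nat \<Rightarrow> 'a measure) \<Rightarrow> (nat \<Rightarrow> 'a \<Rightarrow> (real ^ 'm) set)
    \<Rightarrow> (nat \<Rightarrow> 'a \<Rightarrow> real ^ 'm) \<Rightarrow> (nat \<Rightarrow> 'a \<Rightarrow> real ^ 'n) \<Rightarrow> bool" where
  "is_solution M T IX IU w f L K G \<Gamma> u x \<longleftrightarrow>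
     admissible M T IX IU w f G \<Gamma> u x \<and>
     (\<forall>u' x'. admissible M T IX IU w f G \<Gamma> u' x' \<longrightarrow>
        expected_cost M T w L K u x \<le> expected_cost M T w L K u' x')"

end

theory Submission
  imports Defs
begin

text \<open>
  Only the control at one time \<open>t\<close> is varied. Outcome by outcome, the reduced cost is continuously
  differentiable in \<open>u\<^sub>t\<close>, and the chain rule applied to the cost-to-go identifies its gradient with
  \<open>g = (L\<^sub>t)'\<^sub>u + (f\<^sub>t)'\<^sub>u \<lambda>\<^bsub>t+1\<^esub>\<close>. The gradient is square integrable along every square integrable control, also
  along \<open>u\<^sub>t + \<sigma> (v - u\<^sub>t)\<close> with a random \<open>\<sigma>\<close> in \<open>[0, 1]\<close>. A nearly maximising \<open>\<sigma>\<close> gives a dominating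
  function, so that one can differentiate under the expectation, and optimality yields
  \<open>E \<langle>g, v - u\<^sub>t\<rangle> \<ge> 0\<close> for all admissible \<open>v\<close>; here \<open>g\<close> may be replaced by \<open>r = E(g | G\<^sub>t)\<close>. Taking for \<open>v\<close>
  the projection of \<open>u\<^sub>t - r\<close> onto \<open>\<Gamma>\<^sub>t\<close>, which is \<open>G\<^sub>t\<close>-measurable, shows that \<open>u\<^sub>t\<close> is itself this projection.
  Hence \<open>- r\<close> is pointwise normal to \<open>\<Gamma>\<^sub>t\<close> at \<open>u\<^sub>t\<close>, which gives the inequality against controls
  that need not be \<open>G\<^sub>t\<close>-measurable.
\<close>

section \<open>Continuously differentiable maps on subspaces\<close>

text \<open>A derivative within \<open>V\<close> says nothing about directions off \<open>V\<close>.
  The whole line through \<open>x\<close> in direction \<open>h\<close> stays in \<open>V\<close>,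
  so along it the chain rule gives an ordinary derivative in the real variable
  \<open>s\<close>.\<close>

lemma has_vector_derivative_along_line:
  assumes V: "subspace V" and x: "x \<in> V" and h: "h \<in> V"
    and D: "(\<phi> has_derivative D) (at (x + s *\<^sub>R h) within V)"
  shows "((\<lambda>s. \<phi> (x + s *\<^sub>R h)) has_vector_derivative D h) (at s)"
proof -
  let ?l = "\<lambda>s::real. x + s *\<^sub>R h"
  have l: "(?l has_derivative (\<lambda>r. r *\<^sub>R h)) (at s)"
    by (auto intro!: derivative_eq_intros)
  have "range ?l \<subseteq> V"
    using V x h by (auto simp: subspace_def)
  then have "(\<phi> has_derivative D) (at (?l s) within range ?l)"
    using has_derivative_subset[OF D] by blast
  with l have "((\<lambda>s. \<phi> (?l s)) has_derivative (\<lambda>r. D (r *\<^sub>R h))) (at s)"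
    using diff_chain_within[of ?l "\<lambda>r. r *\<^sub>R h" s UNIV \<phi> D] by (simp add: o_def)
  then show ?thesis
    using linear_cmul[OF has_derivative_linear[OF D]] by (simp add: has_vector_derivative_def)
qed

text \<open>Let \<open>r\<close> be the part of \<open>D h\<close> orthogonal to \<open>W\<close>.
  The function \<open>inner r (\<phi> z)\<close> vanishes along the line in direction
  \<open>h\<close>, so its derivative \<open>inner r (D h)\<close>, which is the squared norm of
  \<open>r\<close>, is zero. The chain rule for \<open>deriv_T\<close> needs this, since a
  transposed derivative along \<open>W\<close> represents only directions in
  \<open>W\<close>.\<close>

lemma has_derivative_in_subspace:
  fixes \<phi> :: "'v::real_normed_vector \<Rightarrow> 'w::euclidean_space"
  assumes V: "subspace V" and W: "subspace W" and x: "x \<in> V" and h: "h \<in> V"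
    and range: "\<And>z. z \<in> V \<Longrightarrow> \<phi> z \<in> W"
    and D: "(\<phi> has_derivative D) (at x within V)"
  shows "D h \<in> W"
proof -
  obtain g r where g: "g \<in> span W" "\<And>k. k \<in> span W \<Longrightarrow> orthogonal r k" "D h = g + r"
    using orthogonal_subspace_decomp_exists[of W "D h"] by blast
  have sp: "span W = W"
    using W by (simp only: span_eq_iff)
  have "((\<lambda>z. inner r (\<phi> z)) has_derivative (\<lambda>k. inner r (D k))) (at (x + 0 *\<^sub>R h) within V)"
    using D by (auto intro!: derivative_eq_intros)
  from has_vector_derivative_along_line[OF V x h this]
  have "((\<lambda>s. inner r (\<phi> (x + s *\<^sub>R h))) has_vector_derivative inner r (D h)) (at 0)" .
  moreover have "inner r (\<phi> (x + s *\<^sub>R h)) = 0" for s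
    using g(2) range V x h by (simp add: sp orthogonal_def subspace_def)
  ultimately have "inner r (D h) = 0"
    using vector_derivative_unique_at[of "\<lambda>_. 0" "inner r (D h)" 0 0] by simp
  moreover have "inner r g = 0"
    using g by (simp add: orthogonal_def)
  ultimately have "r = 0"
    using g(3) by (simp add: inner_add_right)
  then show ?thesis
    using g sp by simp
qed

section \<open>Calculus of continuously differentiable maps\<close>

lemma C1_onI:
  assumes "\<And>x. x \<in> V \<Longrightarrow> (\<phi> has_derivative blinfun_apply (D x)) (at x within V)"
    and "continuous_on V D"
  shows "C1_on V \<phi>"
  using assms unfolding C1_on_def by (intro exI[of _ D]) simp

lemma C1_on_compose:
  assumes "C1_on V \<phi>" and "C1_on W \<psi>" and range: "\<And>z. z \<in> V \<Longrightarrow> \<phi> z \<in> W"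
  shows "C1_on V (\<lambda>z. \<psi> (\<phi> z))"
proof -
  obtain D where D: "\<And>z. z \<in> V \<Longrightarrow> (\<phi> has_derivative blinfun_apply (D z)) (at z within V)"
      "continuous_on V D"
    using assms(1) by (auto simp: C1_on_def)
  obtain E where E: "\<And>z. z \<in> W \<Longrightarrow> (\<psi> has_derivative blinfun_apply (E z)) (at z within W)"
      "continuous_on W E"
    using assms(2) by (auto simp: C1_on_def)
  have "continuous_on V \<phi>"
    using D(1) by (meson continuous_on_eq_continuous_within has_derivative_continuous)
  then have "continuous_on V (\<lambda>z. E (\<phi> z))"
    using E(2) range by (auto intro!: continuous_on_compose2[of W E])
  then have "continuous_on V (\<lambda>z. E (\<phi> z) o\<^sub>L D z)"
    using D(2) by (intro continuous_intros)
  moreover have "((\<lambda>z. \<psi> (\<phi> z)) has_derivative blinfun_apply (E (\<phi> z) o\<^sub>L D z)) (at z within V)"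
    if "z \<in> V" for z
  proof -
    have "(\<psi> has_derivative blinfun_apply (E (\<phi> z))) (at (\<phi> z) within \<phi> ` V)"
      using E(1)[OF range[OF that]] range by (auto intro: has_derivative_subset)
    from diff_chain_within[OF D(1)[OF that] this] show ?thesis
      by (simp add: o_def blinfun_compose.rep_eq)
  qed
  ultimately show ?thesis
    by (rule C1_onI[rotated])
qed

lemma C1_on_add:
  assumes "C1_on V \<phi>" and "C1_on V \<psi>"
  shows "C1_on V (\<lambda>z. \<phi> z + \<psi> z)"
proof -
  obtain D where D: "\<And>z. z \<in> V \<Longrightarrow> (\<phi> has_derivative blinfun_apply (D z)) (at z within V)"
      "continuous_on V D"
    using assms(1) by (auto simp: C1_on_def)
  obtain E where E: "\<And>z. z \<in> V \<Longrightarrow> (\<psi> has_derivative blinfun_apply (E z)) (at z within V)"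
      "continuous_on V E"
    using assms(2) by (auto simp: C1_on_def)
  have "continuous_on V (\<lambda>z. D z + E z)"
    using D(2) E(2) by (intro continuous_intros)
  moreover have "((\<lambda>z. \<phi> z + \<psi> z) has_derivative blinfun_apply (D z + E z)) (at z within V)"
    if "z \<in> V" for z
    using has_derivative_add[OF D(1)[OF that] E(1)[OF that]] by (simp add: plus_blinfun.rep_eq)
  ultimately show ?thesis
    by (rule C1_onI[rotated])
qed

lemma C1_on_affine:
  assumes "bounded_linear A" and "\<And>z. \<phi> z = c + A z"
  shows "C1_on V \<phi>"
proof (rule C1_onI)
  have "\<phi> = (\<lambda>z. c + A z)"
    using assms(2) by blast
  then show "(\<phi> has_derivative blinfun_apply (Blinfun A)) (at z within V)" for z
    using has_derivative_add[OF has_derivative_const bounded_linear_imp_has_derivative[OF assms(1)]]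
    by (simp add: bounded_linear_Blinfun_apply[OF assms(1)])
qed simp

lemma C1_on_const: "C1_on V (\<lambda>_. c)"
  by (rule C1_on_affine[of "\<lambda>_. 0" _ c]) auto

text \<open>The embedding of a slice is affine, so smoothness in state and control jointly passes to
  the state alone; the next lemma does the same for the control.\<close>

lemma C1_on_Pair1:
  assumes "C1_on (V \<times> W) (\<lambda>(a, b). \<phi> a b)" and "b \<in> W"
  shows "C1_on V (\<lambda>a. \<phi> a b)"
proof -
  have "C1_on V (\<lambda>a. (a, b))"
    by (rule C1_on_affine[of "\<lambda>a. (a, 0)" _ "(0, b)"])
      (auto intro: bounded_linear_Pair bounded_linear_ident bounded_linear_zero)
  from C1_on_compose[OF this assms(1)] show ?thesis
    using assms(2) by simp
qed

lemma C1_on_Pair2: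
  assumes "C1_on (V \<times> W) (\<lambda>(a, b). \<phi> a b)" and "a \<in> V"
  shows "C1_on W (\<lambda>b. \<phi> a b)"
proof -
  have "C1_on W (\<lambda>b. (a, b))"
    by (rule C1_on_affine[of "\<lambda>b. (0, b)" _ "(a, 0)"])
      (auto intro: bounded_linear_Pair bounded_linear_ident bounded_linear_zero)
  from C1_on_compose[OF this assms(1)] show ?thesis
    using assms(2) by simp
qed

lemma C1_on_differentiable:
  assumes "C1_on V \<phi>" and "x \<in> V"
  obtains D where "(\<phi> has_derivative D) (at x within V)"
  using assms by (auto simp: C1_on_def)

section \<open>Calculus of transposed derivatives\<close>

lemma deriv_T_eqI:
  fixes \<phi> :: "'v::euclidean_space \<Rightarrow> 'b::real_inner"
  assumes V: "subspace V" and x: "x \<in> V" and D: "(\<phi> has_derivative D) (at x within V)"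
    and g: "g \<in> V" "\<And>h. h \<in> V \<Longrightarrow> inner g h = inner \<mu> (D h)"
  shows "deriv_T V \<phi> x \<mu> = g"
proof -
  note d = deriv_T_works[OF V x D]
  \<comment> \<open>Two representers of the same functional on \<open>V\<close> differ by an element
    of \<open>V\<close> that is orthogonal to \<open>V\<close>, hence to itself.\<close>
  have m: "deriv_T V \<phi> x \<mu> - g \<in> V"
    using V d(1) g(1) by (rule subspace_diff)
  have "inner (deriv_T V \<phi> x \<mu> - g) (deriv_T V \<phi> x \<mu> - g) = 0"
    using d(2)[OF m] g(2)[OF m] by (simp add: inner_diff_left)
  then show ?thesis
    by simp
qed

lemma deriv_T_add:
  fixes \<phi> \<psi> :: "'v::euclidean_space \<Rightarrow> 'b::real_inner"
  assumes V: "subspace V" and x: "x \<in> V" and "C1_on V \<phi>" and "C1_on V \<psi>"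
  shows "deriv_T V (\<lambda>z. \<phi> z + \<psi> z) x \<mu> = deriv_T V \<phi> x \<mu> + deriv_T V \<psi> x \<mu>"
proof -
  obtain D where D: "(\<phi> has_derivative D) (at x within V)"
    using assms by (blast elim: C1_on_differentiable)
  obtain E where E: "(\<psi> has_derivative E) (at x within V)"
    using assms by (blast elim: C1_on_differentiable)
  show ?thesis
    using deriv_T_works[OF V x D] deriv_T_works[OF V x E]
    by (intro deriv_T_eqI[OF V x has_derivative_add[OF D E]])
      (auto simp: subspace_add[OF V] inner_add_left inner_add_right)
qed

lemma deriv_T_const:
  fixes c :: "'b::real_inner"
  assumes "subspace V" and "x \<in> V"
  shows "deriv_T V (\<lambda>_. c) x \<mu> = 0"
  using assms by (intro deriv_T_eqI[OF assms has_derivative_const]) (auto simp: subspace_0)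

text \<open>Transposition reverses composition: \<open>inner \<mu> (E (D h))\<close> is rewritten
  first by the representer along \<open>W\<close> and then by the one along \<open>V\<close>. The
  first rewriting requires \<open>D h\<close> to lie in \<open>W\<close>.\<close>

lemma deriv_T_compose:
  fixes \<phi> :: "'v::euclidean_space \<Rightarrow> 'w::euclidean_space" and \<psi> :: "'w \<Rightarrow> 'b::real_inner"
  assumes V: "subspace V" and W: "subspace W" and x: "x \<in> V"
    and "C1_on V \<phi>" and "C1_on W \<psi>" and range: "\<And>z. z \<in> V \<Longrightarrow> \<phi> z \<in> W"
  shows "deriv_T V (\<lambda>z. \<psi> (\<phi> z)) x \<mu> = deriv_T V \<phi> x (deriv_T W \<psi> (\<phi> x) \<mu>)"
proof -
  obtain D where D: "(\<phi> has_derivative D) (at x within V)"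
    using assms by (blast elim: C1_on_differentiable)
  obtain E where E: "(\<psi> has_derivative E) (at (\<phi> x) within W)"
    using assms by (blast elim: C1_on_differentiable)
  have "(\<psi> has_derivative E) (at (\<phi> x) within \<phi> ` V)"
    using E range by (auto intro: has_derivative_subset)
  from diff_chain_within[OF D this]
  have C: "((\<lambda>z. \<psi> (\<phi> z)) has_derivative (\<lambda>h. E (D h))) (at x within V)"
    by (simp add: o_def)
  show ?thesis
    using deriv_T_works[OF V x D] deriv_T_works(2)[OF W range[OF x] E]
      has_derivative_in_subspace[OF V W x _ range D]
    by (intro deriv_T_eqI[OF V x C]) auto
qed

text \<open>This prepares differentiation under the expectation. Tested against \<open>h\<close> in
  \<open>V\<close>, the gradient agrees with the continuous derivative \<open>D\<close>, from which
  it inherits continuity in \<open>s\<close>.\<close>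

lemma C1_on_line:
  fixes \<phi> :: "'v::euclidean_space \<Rightarrow> real"
  assumes V: "subspace V" and "C1_on V \<phi>" and x: "x \<in> V" and h: "h \<in> V"
  shows "((\<lambda>s. \<phi> (x + s *\<^sub>R h)) has_real_derivative inner (deriv_T V \<phi> (x + s *\<^sub>R h) 1) h) (at s)"
    and "continuous_on UNIV (\<lambda>s. inner (deriv_T V \<phi> (x + s *\<^sub>R h) 1) h)"
proof -
  obtain D where D: "\<And>z. z \<in> V \<Longrightarrow> (\<phi> has_derivative blinfun_apply (D z)) (at z within V)"
      "continuous_on V D"
    using assms(2) by (auto simp: C1_on_def)
  have mem: "x + s *\<^sub>R h \<in> V" for s
    using V x h by (simp add: subspace_def)
  have eq: "inner (deriv_T V \<phi> (x + s *\<^sub>R h) 1) h = D (x + s *\<^sub>R h) h" for s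
    using deriv_T_works(2)[OF V mem D(1)[OF mem] h] by simp
  show "((\<lambda>s. \<phi> (x + s *\<^sub>R h)) has_real_derivative inner (deriv_T V \<phi> (x + s *\<^sub>R h) 1) h) (at s)"
    using has_vector_derivative_along_line[OF V x h D(1)[OF mem]]
    by (simp add: eq has_real_derivative_iff_has_vector_derivative)
  have "continuous_on UNIV (\<lambda>s. D (x + s *\<^sub>R h))"
    using mem by (intro continuous_on_compose2[OF D(2)] continuous_intros) auto
  then show "continuous_on UNIV (\<lambda>s. inner (deriv_T V \<phi> (x + s *\<^sub>R h) 1) h)"
    unfolding eq by (intro continuous_intros)
qed

section \<open>The co-state as derivative of the cost-to-go\<close>

text \<open>As in \<open>costate_back\<close>, the index \<open>k\<close> counts the remaining steps: the current time is \<open>T - k\<close>.\<close>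

primrec cost_to_go ::
  "nat \<Rightarrow> ('n::finite, 'm::finite, real ^ 'n) stage_map \<Rightarrow> ('n, 'm, real) stage_map
    \<Rightarrow> (real ^ 'n \<Rightarrow> real) \<Rightarrow> (nat \<Rightarrow> real ^ 'm) \<Rightarrow> (nat \<Rightarrow> real ^ 'n) \<Rightarrow> nat \<Rightarrow> real ^ 'n \<Rightarrow> real" where
  "cost_to_go T f L K u w 0 = K"
| "cost_to_go T f L K u w (Suc k) =
     (let t = T - Suc k in (\<lambda>z.
        L t z (u t) (w (Suc t)) + cost_to_go T f L K u w k (f t z (u t) (w (Suc t)))))"

text \<open>Each step of the induction moves the last remaining stage, at time
  \<open>T - Suc k\<close>, from the sum into the cost-to-go.\<close>

lemma path_cost_eq_cost_to_go:
  assumes "k \<le> T"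
  shows "reduced_cost T f L K u w =
    (\<Sum>t<T - k. L t (state f u w t) (u t) (w (Suc t)))
      + cost_to_go T f L K u w k (state f u w (T - k))"
  using assms
proof (induction k)
  case 0
  then show ?case
    by (simp add: reduced_cost_def path_cost_def)
next
  case (Suc k)
  then have "T - k = Suc (T - Suc k)"
    by simp
  then show ?case
    using Suc by (simp add: Let_def)
qed

lemma state_cong:
  "(\<And>s. s < t \<Longrightarrow> u s = v s) \<Longrightarrow> state f u w t = state f v w t"
  by (induction t) auto

lemma cost_to_go_cong:
  "k \<le> T \<Longrightarrow> (\<And>s. T - k \<le> s \<Longrightarrow> s < T \<Longrightarrow> u s = v s) \<Longrightarrow> cost_to_go T f L K u w k z = cost_to_go T f L K v w k z"
  by (induction k arbitrary: z) (auto simp: Let_def)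

text \<open>Causality isolates the control at time \<open>t\<close>: the states up to time
  \<open>t\<close> depend on earlier controls only, and the cost-to-go from \<open>Suc t\<close> as
  a function of its initial state depends on later controls only. Hence \<open>v\<close> enters
  through stage \<open>t\<close> alone.\<close>

lemma reduced_cost_update:
  assumes "t < T"
  shows "reduced_cost T f L K (u(t := v)) w =
    (\<Sum>s<t. L s (state f u w s) (u s) (w (Suc s)))
      + (L t (state f u w t) v (w (Suc t))
         + cost_to_go T f L K u w (T - Suc t) (f t (state f u w t) v (w (Suc t))))"
proof -
  let ?u = "u(t := v)"
  have st: "state f ?u w s = state f u w s" if "s \<le> t" for s
    using that by (intro state_cong) auto
  have "T - (T - Suc t) = Suc t"
    using assms by simp
  moreover have "cost_to_go T f L K ?u w (T - Suc t) z = cost_to_go T f L K u w (T - Suc t) z" for z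
    using assms by (intro cost_to_go_cong) auto
  ultimately show ?thesis
    using path_cost_eq_cost_to_go[of "T - Suc t" T f L K ?u w] by (simp add: st)
qed

section \<open>Pathwise derivatives for one fixed control and noise sequence\<close>

context
  fixes T :: nat and IW IX :: "nat \<Rightarrow> 'n::finite set" and IU :: "nat \<Rightarrow> 'm::finite set"
    and f :: "('n, 'm, real ^ 'n) stage_map" and L :: "('n, 'm, real) stage_map"
    and K :: "real ^ 'n \<Rightarrow> real"
    and u :: "nat \<Rightarrow> real ^ 'm" and w :: "nat \<Rightarrow> real ^ 'n"
  assumes IW0: "IW 0 = IX 0"
    and u_mem: "\<And>t. t < T \<Longrightarrow> u t \<in> coord_space (IU t)"
    and w_mem: "\<And>t. t \<le> T \<Longrightarrow> w t \<in> coord_space (IW t)"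
    and dynamics_range: "\<And>t a b c. t < T \<Longrightarrow> a \<in> coord_space (IX t) \<Longrightarrow> b \<in> coord_space (IU t)
          \<Longrightarrow> c \<in> coord_space (IW (Suc t)) \<Longrightarrow> f t a b c \<in> coord_space (IX (Suc t))"
    and f_C1: "\<And>t c. t < T \<Longrightarrow> c \<in> coord_space (IW (Suc t)) \<Longrightarrow>
          C1_on (coord_space (IX t) \<times> coord_space (IU t)) (\<lambda>(a, b). f t a b c)"
    and L_C1: "\<And>t c. t < T \<Longrightarrow> c \<in> coord_space (IW (Suc t)) \<Longrightarrow>
          C1_on (coord_space (IX t) \<times> coord_space (IU t)) (\<lambda>(a, b). L t a b c)"
    and K_C1: "C1_on (coord_space (IX T)) K"
begin

lemma state_mem: "t \<le> T \<Longrightarrow> state f u w t \<in> coord_space (IX t)"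
proof (induction t)
  case 0
  then show ?case
    using w_mem[of 0] IW0 by simp
next
  case (Suc t)
  then show ?case
    using dynamics_range[of t] u_mem[of t] w_mem[of "Suc t"] by simp
qed

lemma cost_to_go_C1: "k \<le> T \<Longrightarrow> C1_on (coord_space (IX (T - k))) (cost_to_go T f L K u w k)"
proof (induction k)
  case 0
  then show ?case
    using K_C1 by simp
next
  case (Suc k)
  define t where "t = T - Suc k"
  have t: "t < T" "T - k = Suc t"
    using Suc.prems by (auto simp: t_def)
  note mem = u_mem[OF t(1)] w_mem[OF Suc_leI[OF t(1)]]
  have V: "C1_on (coord_space (IX (Suc t))) (cost_to_go T f L K u w k)"
    using Suc t by simp
  have F: "C1_on (coord_space (IX t)) (\<lambda>z. f t z (u t) (w (Suc t)))"
    by (rule C1_on_Pair1[OF f_C1[OF t(1) mem(2)] mem(1)])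
  have Lz: "C1_on (coord_space (IX t)) (\<lambda>z. L t z (u t) (w (Suc t)))"
    by (rule C1_on_Pair1[OF L_C1[OF t(1) mem(2)] mem(1)])
  have R: "f t z (u t) (w (Suc t)) \<in> coord_space (IX (Suc t))" if "z \<in> coord_space (IX t)" for z
    by (rule dynamics_range[OF t(1) that mem])
  note C1_on_add[OF Lz C1_on_compose[OF F V R]]
  then show ?case
    by (simp add: Let_def flip: t_def)
qed

text \<open>Differentiating the recursion of the cost-to-go with the sum and chain rules reproduces
  the adjoint recursion. The controls are held fixed, so no minimisation enters and plain
  differentiability suffices.\<close>

lemma costate_back_eq_deriv_T:
  "k \<le> T \<Longrightarrow> costate_back T IX f L K u w k =
     deriv_T (coord_space (IX (T - k))) (cost_to_go T f L K u w k) (state f u w (T - k)) 1"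
proof (induction k)
  case (Suc k)
  define t where "t = T - Suc k"
  have t: "t < T" "T - k = Suc t"
    using Suc.prems by (auto simp: t_def)
  note mem = u_mem[OF t(1)] w_mem[OF Suc_leI[OF t(1)]] state_mem[OF less_imp_le[OF t(1)]]
  have V: "C1_on (coord_space (IX (Suc t))) (cost_to_go T f L K u w k)"
    using cost_to_go_C1[of k] Suc.prems t by simp
  have F: "C1_on (coord_space (IX t)) (\<lambda>z. f t z (u t) (w (Suc t)))"
    by (rule C1_on_Pair1[OF f_C1[OF t(1) mem(2)] mem(1)])
  have Lz: "C1_on (coord_space (IX t)) (\<lambda>z. L t z (u t) (w (Suc t)))"
    by (rule C1_on_Pair1[OF L_C1[OF t(1) mem(2)] mem(1)])
  have R: "f t z (u t) (w (Suc t)) \<in> coord_space (IX (Suc t))" if "z \<in> coord_space (IX t)" for z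
    by (rule dynamics_range[OF t(1) that mem(1,2)])
  note deriv_T_add[OF subspace_coord_space mem(3) Lz C1_on_compose[OF F V R], of 1]
  also note deriv_T_compose[OF subspace_coord_space subspace_coord_space mem(3) F V R, of 1]
  finally have "deriv_T (coord_space (IX t)) (\<lambda>z. L t z (u t) (w (Suc t))
      + cost_to_go T f L K u w k (f t z (u t) (w (Suc t)))) (state f u w t) 1
    = deriv_T (coord_space (IX t)) (\<lambda>z. L t z (u t) (w (Suc t))) (state f u w t) 1
      + deriv_T (coord_space (IX t)) (\<lambda>z. f t z (u t) (w (Suc t))) (state f u w t)
          (deriv_T (coord_space (IX (Suc t))) (cost_to_go T f L K u w k)
             (f t (state f u w t) (u t) (w (Suc t))) 1)" .
  then show ?case
    using Suc t by (simp add: Let_def deriv_x_T_def flip: t_def)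
qed simp

text \<open>By \<open>reduced_cost_update\<close> the past is constant in \<open>v\<close>. The
  chain rule through the dynamics evaluates the gradient of the cost-to-go at the state of time
  \<open>Suc t\<close>, and this gradient is the co-state there.\<close>

lemma reduced_cost_C1:
  assumes t: "t < T"
  shows "C1_on (coord_space (IU t)) (\<lambda>v. reduced_cost T f L K (u(t := v)) w)"
    and "deriv_T (coord_space (IU t)) (\<lambda>v. reduced_cost T f L K (u(t := v)) w) (u t) 1 =
      deriv_u_T (IU t) (L t) (state f u w t) (u t) (w (Suc t)) 1
      + deriv_u_T (IU t) (f t) (state f u w t) (u t) (w (Suc t)) (costate T IX f L K u w (Suc t))"
proof -
  have k: "T - Suc t \<le> T" "T - (T - Suc t) = Suc t"
    using t by auto
  let ?x = "state f u w t" and ?w = "w (Suc t)" and ?V = "cost_to_go T f L K u w (T - Suc t)"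
    and ?U = "coord_space (IU t)" and ?X = "coord_space (IX (Suc t))"
  note mem = u_mem[OF t] w_mem[OF Suc_leI[OF t]] state_mem[OF less_imp_le[OF t]]
  have V: "C1_on ?X ?V"
    using cost_to_go_C1[OF k(1)] k by simp
  have F: "C1_on ?U (\<lambda>v. f t ?x v ?w)"
    by (rule C1_on_Pair2[OF f_C1[OF t mem(2)] mem(3)])
  have L: "C1_on ?U (\<lambda>v. L t ?x v ?w)"
    by (rule C1_on_Pair2[OF L_C1[OF t mem(2)] mem(3)])
  have R: "\<And>v. v \<in> ?U \<Longrightarrow> f t ?x v ?w \<in> ?X"
    using mem t by (intro dynamics_range)
  have VF: "C1_on ?U (\<lambda>v. ?V (f t ?x v ?w))"
    by (rule C1_on_compose[OF F V R])
  show "C1_on ?U (\<lambda>v. reduced_cost T f L K (u(t := v)) w)"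
    unfolding reduced_cost_update[OF t] by (intro C1_on_add C1_on_const L VF)
  have "deriv_T ?U (\<lambda>v. reduced_cost T f L K (u(t := v)) w) (u t) 1
      = deriv_T ?U (\<lambda>v. L t ?x v ?w) (u t) 1 + deriv_T ?U (\<lambda>v. ?V (f t ?x v ?w)) (u t) 1"
    unfolding reduced_cost_update[OF t]
    by (simp only: deriv_T_add[OF subspace_coord_space mem(1) C1_on_const C1_on_add[OF L VF]]
        deriv_T_add[OF subspace_coord_space mem(1) L VF]
        deriv_T_const[OF subspace_coord_space mem(1)] add_0_left)
  also have "deriv_T ?U (\<lambda>v. ?V (f t ?x v ?w)) (u t) 1
      = deriv_T ?U (\<lambda>v. f t ?x v ?w) (u t) (deriv_T ?X ?V (f t ?x (u t) ?w) 1)"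
    by (rule deriv_T_compose[OF subspace_coord_space subspace_coord_space mem(1) F V R])
  also have "deriv_T ?X ?V (f t ?x (u t) ?w) 1 = costate T IX f L K u w (Suc t)"
    unfolding costate_def using costate_back_eq_deriv_T[OF k(1)] k(2) by simp
  finally show "deriv_T ?U (\<lambda>v. reduced_cost T f L K (u(t := v)) w) (u t) 1 =
      deriv_u_T (IU t) (L t) ?x (u t) ?w 1
      + deriv_u_T (IU t) (f t) ?x (u t) ?w (costate T IX f L K u w (Suc t))"
    by (simp only: deriv_u_T_def)
qed

end

section \<open>Measurability\<close>

lemma measurable_coord_borel_iff:
  "v \<in> N \<rightarrow>\<^sub>M coord_borel I \<longleftrightarrow> v \<in> borel_measurable N \<and> (\<forall>\<omega>\<in>space N. v \<omega> \<in> coord_space I)"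
  by (auto simp: measurable_restrict_space2_iff)

lemma borel_measurable_vec_componentwise:
  fixes v :: "'a \<Rightarrow> real ^ 'n::finite"
  assumes "\<And>i. (\<lambda>\<omega>. v \<omega> $ i) \<in> borel_measurable N"
  shows "v \<in> borel_measurable N"
  unfolding borel_measurable_euclidean_space[of v]
  using assms by (auto simp: Basis_vec_def inner_axis)

lemma measurable_coord_borelI:
  assumes "\<And>i. i \<in> I \<Longrightarrow> (\<lambda>\<omega>. v \<omega> $ i) \<in> borel_measurable N"
    and "\<And>\<omega>. \<omega> \<in> space N \<Longrightarrow> v \<omega> \<in> coord_space I"
  shows "v \<in> N \<rightarrow>\<^sub>M coord_borel I"
  unfolding measurable_coord_borel_iff
proof (intro conjI borel_measurable_vec_componentwise)
  fix i
  show "(\<lambda>\<omega>. v \<omega> $ i) \<in> borel_measurable N"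
  proof (cases "i \<in> I")
    case False
    then have "(\<lambda>\<omega>. v \<omega> $ i) \<in> borel_measurable N \<longleftrightarrow> (\<lambda>_. 0 :: real) \<in> borel_measurable N"
      using assms(2) by (intro measurable_cong) (auto simp: coord_space_def)
    then show ?thesis
      by simp
  qed (rule assms(1))
qed (use assms(2) in blast)

text \<open>Measurability of \<open>\<Gamma>\<close> concerns a fixed open set, whereas this ball
  moves with the outcome. The moving ball is exhausted by fixed balls with centre in a countable
  dense set and rational radius, each used on the measurable event that it lies well inside.\<close>

lemma measurable_setmap_hits_ball:
  fixes \<Gamma> :: "'p \<Rightarrow> 'v::euclidean_space set"
  assumes \<Gamma>: "measurable_setmap N \<Gamma>" and S: "open S"
    and [measurable]: "z \<in> borel_measurable N" "a \<in> borel_measurable N"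
  shows "{\<omega> \<in> space N. \<Gamma> \<omega> \<inter> S \<inter> ball (z \<omega>) (a \<omega>) \<noteq> {}} \<in> sets N"
proof -
  obtain D :: "'v set" where D: "countable D" "\<And>X. open X \<Longrightarrow> X \<noteq> {} \<Longrightarrow> \<exists>d\<in>D. d \<in> X"
    by (rule countable_dense_setE) blast
  let ?H = "\<lambda>p b. {\<omega> \<in> space N. dist (z \<omega>) p + b < a \<omega>} \<inter> {\<omega> \<in> space N. \<Gamma> \<omega> \<inter> (S \<inter> ball p b) \<noteq> {}}"
  have "\<exists>p\<in>D. \<exists>b\<in>\<rat>. \<omega> \<in> ?H p b"
    if \<omega>: "\<omega> \<in> space N" and y: "y \<in> \<Gamma> \<omega>" "y \<in> S" "dist (z \<omega>) y < a \<omega>" for \<omega> y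
  proof -
    \<comment> \<open>One third of the slack: the centre \<open>p\<close> is chosen within
      \<open>e\<close> of \<open>y\<close> and the radius \<open>b\<close> between \<open>e\<close>
      and \<open>2 * e\<close>, so the fixed ball contains \<open>y\<close> and still fits into the
      moving one.\<close>
    define e where "e = (a \<omega> - dist (z \<omega>) y) / 3"
    have e: "0 < e"
      using y by (simp add: e_def)
    with D(2)[of "ball y e"] obtain p where p: "p \<in> D" "dist p y < e"
      by (auto simp: dist_commute)
    from Rats_dense_in_real[of e "2 * e"] e obtain b where b: "b \<in> \<rat>" "e < b" "b < 2 * e"
      by auto
    have "dist (z \<omega>) p \<le> dist (z \<omega>) y + dist p y"
      by (metis dist_commute dist_triangle)
    then have "dist (z \<omega>) p + b < a \<omega>"
      using p b by (simp add: e_def field_simps)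
    with p b y \<omega> show ?thesis
      by (intro bexI[of _ p] bexI[of _ b]) auto
  qed
  moreover have "y \<in> ball (z \<omega>) (a \<omega>)" if "dist (z \<omega>) p + b < a \<omega>" "y \<in> ball p b" for \<omega> y p b
    using that dist_triangle[of "z \<omega>" y p] by simp
  ultimately have "{\<omega> \<in> space N. \<Gamma> \<omega> \<inter> S \<inter> ball (z \<omega>) (a \<omega>) \<noteq> {}} = (\<Union>p\<in>D. \<Union>b\<in>\<rat>. ?H p b)"
    by fastforce
  also have "\<dots> \<in> sets N"
  proof -
    have "?H p b \<in> sets N" for p b
    proof (rule sets.Int)
      show "{\<omega> \<in> space N. \<Gamma> \<omega> \<inter> (S \<inter> ball p b) \<noteq> {}} \<in> sets N"
        using \<Gamma> open_Int[OF S open_ball, of p b] unfolding measurable_setmap_def by blast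
    qed measurable
    then show ?thesis
      using D(1) by (intro sets.countable_UN'' countable_rat)
  qed
  finally show ?thesis .
qed

text \<open>As the values are closed, membership of \<open>z \<omega>\<close> means that every ball
  around it of radius \<open>1 / (n + 1)\<close> meets \<open>\<Gamma> \<omega>\<close>, a countable
  intersection of measurable events.\<close>

lemma measurable_setmap_mem:
  fixes \<Gamma> :: "'p \<Rightarrow> 'v::euclidean_space set"
  assumes \<Gamma>: "measurable_setmap N \<Gamma>" and closed: "\<And>\<omega>. \<omega> \<in> space N \<Longrightarrow> closed (\<Gamma> \<omega>)"
    and z: "z \<in> borel_measurable N"
  shows "{\<omega> \<in> space N. z \<omega> \<in> \<Gamma> \<omega>} \<in> sets N"
proof -
  have "z \<omega> \<in> \<Gamma> \<omega> \<longleftrightarrow> (\<forall>n. \<Gamma> \<omega> \<inter> UNIV \<inter> ball (z \<omega>) (inverse (real (Suc n))) \<noteq> {})"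
    if \<omega>: "\<omega> \<in> space N" for \<omega>
  proof (intro iffI allI)
    assume "z \<omega> \<in> \<Gamma> \<omega>"
    then show "\<Gamma> \<omega> \<inter> UNIV \<inter> ball (z \<omega>) (inverse (real (Suc n))) \<noteq> {}" for n
      using centre_in_ball[of "z \<omega>" "inverse (real (Suc n))"] by auto
  next
    assume H: "\<forall>n. \<Gamma> \<omega> \<inter> UNIV \<inter> ball (z \<omega>) (inverse (real (Suc n))) \<noteq> {}"
    show "z \<omega> \<in> \<Gamma> \<omega>"
      unfolding closed_approachable[OF closed[OF \<omega>], symmetric]
    proof (intro allI impI)
      fix e :: real assume "0 < e"
      then obtain n where "inverse (real (Suc n)) < e"
        using reals_Archimedean by blast
      moreover from H obtain y where "y \<in> \<Gamma> \<omega>" "dist (z \<omega>) y < inverse (real (Suc n))"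
        by (auto simp: Int_def)
      ultimately show "\<exists>y\<in>\<Gamma> \<omega>. dist y (z \<omega>) < e"
        by (metis dist_commute order_less_trans)
    qed
  qed
  then have "{\<omega> \<in> space N. z \<omega> \<in> \<Gamma> \<omega>} =
      (\<Inter>n. {\<omega> \<in> space N. \<Gamma> \<omega> \<inter> UNIV \<inter> ball (z \<omega>) (inverse (real (Suc n))) \<noteq> {}})"
    by blast
  also have "\<dots> \<in> sets N"
    using measurable_setmap_hits_ball[OF \<Gamma> open_UNIV z borel_measurable_const]
    by (intro sets.countable_INT) blast+
  finally show ?thesis .
qed

text \<open>The sublevel event at \<open>c\<close> says that the moving point
  \<open>(v \<omega>, c)\<close> lies in the epigraph, a closed-valued measurable mapping after
  pulling back along \<open>p\<close>.\<close>

lemma normal_integrand_measurable: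
  fixes \<phi> :: "'p \<Rightarrow> 'v::euclidean_space \<Rightarrow> real"
  assumes \<phi>: "normal_integrand P V \<phi>" and p: "p \<in> N \<rightarrow>\<^sub>M P"
    and v: "v \<in> borel_measurable N" "\<And>\<omega>. \<omega> \<in> space N \<Longrightarrow> v \<omega> \<in> V"
  shows "(\<lambda>\<omega>. \<phi> (p \<omega>) (v \<omega>)) \<in> borel_measurable N"
proof (rule borel_measurableI_le)
  fix c :: real
  let ?E = "\<lambda>\<omega>. epigraph V (\<phi> (p \<omega>))"
  have "measurable_setmap N ?E"
    unfolding measurable_setmap_def
  proof (intro allI impI)
    fix S :: "('v \<times> real) set" assume "open S"
    then have "{c \<in> space P. epigraph V (\<phi> c) \<inter> S \<noteq> {}} \<in> sets P"
      using \<phi> by (auto simp: normal_integrand_def measurable_setmap_def)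
    from measurable_sets[OF p this] show "{\<omega> \<in> space N. ?E \<omega> \<inter> S \<noteq> {}} \<in> sets N"
      by (rule back_subst[of "\<lambda>A. A \<in> sets N"]) (use measurable_space[OF p] in auto)
  qed
  moreover have "closed (?E \<omega>)" if "\<omega> \<in> space N" for \<omega>
    using \<phi> measurable_space[OF p that] by (auto simp: normal_integrand_def)
  ultimately have "{\<omega> \<in> space N. (v \<omega>, c) \<in> ?E \<omega>} \<in> sets N"
    using v(1) by (intro measurable_setmap_mem borel_measurable_Pair) auto
  also have "{\<omega> \<in> space N. (v \<omega>, c) \<in> ?E \<omega>} = {\<omega> \<in> space N. \<phi> (p \<omega>) (v \<omega>) \<le> c}"
    using v(2) by (auto simp: epigraph_def)
  finally show "{\<omega> \<in> space N. \<phi> (p \<omega>) (v \<omega>) \<le> c} \<in> sets N" .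
qed

text \<open>The angle at the projection is not acute. Consequently a point of \<open>S\<close> whose
  distance from \<open>z\<close> is nearly minimal must be close to the projection, with an explicit
  estimate.\<close>

lemma dist_closest_point_le:
  fixes S :: "'v::euclidean_space set"
  assumes S: "convex S" "closed S" and y: "y \<in> S"
  shows "(dist y (closest_point S z))\<^sup>2 \<le> (dist z y)\<^sup>2 - (dist z (closest_point S z))\<^sup>2"
proof -
  define p where "p = closest_point S z"
  have "inner (z - p) (y - p) \<le> 0"
    unfolding p_def by (rule closest_point_dot[OF S y])
  moreover have "(norm (z - y))\<^sup>2 = (norm (z - p))\<^sup>2 - 2 * inner (z - p) (y - p) + (norm (y - p))\<^sup>2"
    by (simp add: power2_norm_eq_inner inner_diff_left inner_diff_right inner_commute)
  ultimately show ?thesis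
    by (simp add: dist_norm flip: p_def)
qed

text \<open>This makes the test control of the variational inequality measurable. The distance to
  \<open>\<Gamma> \<omega>\<close> is treated first; it then serves as the random radius of balls
  that contain only nearly minimal points of \<open>\<Gamma> \<omega>\<close>.\<close>

lemma borel_measurable_closest_point:
  fixes \<Gamma> :: "'p \<Rightarrow> 'v::euclidean_space set"
  assumes \<Gamma>: "measurable_setmap N \<Gamma>"
    and cl: "\<And>\<omega>. \<omega> \<in> space N \<Longrightarrow> closed (\<Gamma> \<omega>)" and co: "\<And>\<omega>. \<omega> \<in> space N \<Longrightarrow> convex (\<Gamma> \<omega>)"
    and ne: "\<And>\<omega>. \<omega> \<in> space N \<Longrightarrow> \<Gamma> \<omega> \<noteq> {}"
    and z [measurable]: "z \<in> borel_measurable N"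
  shows "(\<lambda>\<omega>. closest_point (\<Gamma> \<omega>) (z \<omega>)) \<in> borel_measurable N"
proof -
  define p where "p \<omega> = closest_point (\<Gamma> \<omega>) (z \<omega>)" for \<omega>
  define d where "d \<omega> = dist (z \<omega>) (p \<omega>)" for \<omega>
  have p: "p \<omega> \<in> \<Gamma> \<omega>" if "\<omega> \<in> space N" for \<omega>
    unfolding p_def by (rule closest_point_in_set[OF cl[OF that] ne[OF that]])
  have d: "d \<omega> \<le> dist (z \<omega>) y" if "\<omega> \<in> space N" "y \<in> \<Gamma> \<omega>" for \<omega> y
    unfolding d_def p_def by (rule closest_point_le[OF cl[OF that(1)] that(2)])
  have [measurable]: "d \<in> borel_measurable N"
  proof (rule borel_measurableI_less)
    fix c
    have "{\<omega> \<in> space N. d \<omega> < c} = {\<omega> \<in> space N. \<Gamma> \<omega> \<inter> UNIV \<inter> ball (z \<omega>) c \<noteq> {}}"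
      using p d by (fastforce simp: d_def)
    also have "\<dots> \<in> sets N"
      by (rule measurable_setmap_hits_ball[OF \<Gamma>]) auto
    finally show "{\<omega> \<in> space N. d \<omega> < c} \<in> sets N" .
  qed
  have sets: "p -` C \<inter> space N \<in> sets N" if C: "closed C" "C \<noteq> {}" for C
  proof -
    define e where "e n = inverse (real (Suc n))" for n
    have e: "e n > 0" for n
      by (simp add: e_def)
    have e_lim: "e \<longlonglongrightarrow> 0"
      unfolding e_def[abs_def] by (rule LIMSEQ_inverse_real_of_nat)
    \<comment> \<open>\<open>C\<close> is replaced by open neighbourhoods because
      \<open>measurable_setmap\<close> tests open sets. Nearly minimal points of
      \<open>\<Gamma> \<omega>\<close> in ever smaller neighbourhoods converge to the projection,
      which therefore lies in the closed set \<open>C\<close>.\<close>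
    let ?H = "\<lambda>n \<omega>. \<Gamma> \<omega> \<inter> {y. infdist y C < e n} \<inter> ball (z \<omega>) (d \<omega> + e n) \<noteq> {}"
    have "p \<omega> \<in> C \<longleftrightarrow> (\<forall>n. ?H n \<omega>)" if \<omega>: "\<omega> \<in> space N" for \<omega>
    proof (intro iffI allI)
      fix n assume "p \<omega> \<in> C"
      then have "p \<omega> \<in> \<Gamma> \<omega> \<inter> {y. infdist y C < e n} \<inter> ball (z \<omega>) (d \<omega> + e n)"
        using e[of n] p[OF \<omega>] by (simp add: d_def)
      then show "?H n \<omega>"
        by blast
    next
      assume H: "\<forall>n. ?H n \<omega>"
      have "infdist (p \<omega>) C \<le> e n + sqrt ((d \<omega> + e n)\<^sup>2 - (d \<omega>)\<^sup>2)" for n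
      proof -
        from H obtain y where y: "y \<in> \<Gamma> \<omega>" "infdist y C < e n" "dist (z \<omega>) y < d \<omega> + e n"
          by fastforce
        have "(dist y (p \<omega>))\<^sup>2 \<le> (dist (z \<omega>) y)\<^sup>2 - (d \<omega>)\<^sup>2"
          unfolding d_def p_def by (rule dist_closest_point_le[OF co[OF \<omega>] cl[OF \<omega>] y(1)])
        also have "\<dots> \<le> (d \<omega> + e n)\<^sup>2 - (d \<omega>)\<^sup>2"
          using y(3) by (intro diff_right_mono power_mono) auto
        finally have "dist (p \<omega>) y \<le> sqrt ((d \<omega> + e n)\<^sup>2 - (d \<omega>)\<^sup>2)"
          by (simp add: dist_commute real_le_rsqrt)
        with y(2) infdist_triangle[of "p \<omega>" C y] show ?thesis
          by simp
      qed
      moreover have "(\<lambda>n. e n + sqrt ((d \<omega> + e n)\<^sup>2 - (d \<omega>)\<^sup>2)) \<longlonglongrightarrow> 0 + sqrt ((d \<omega> + 0)\<^sup>2 - (d \<omega>)\<^sup>2)"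
        by (intro tendsto_intros e_lim)
      ultimately have "infdist (p \<omega>) C \<le> 0"
        by (intro LIMSEQ_le_const) auto
      then show "p \<omega> \<in> C"
        using infdist_nonneg[of "p \<omega>" C] by (simp add: in_closed_iff_infdist_zero[OF C])
    qed
    then have "p -` C \<inter> space N = (\<Inter>n. {\<omega> \<in> space N. ?H n \<omega>})"
      by blast
    also have "\<dots> \<in> sets N"
    proof (rule sets.countable_INT)
      have "{\<omega> \<in> space N. ?H n \<omega>} \<in> sets N" for n
        by (intro measurable_setmap_hits_ball[OF \<Gamma>] open_Collect_less continuous_intros) auto
      then show "range (\<lambda>n. {\<omega> \<in> space N. ?H n \<omega>}) \<subseteq> sets N"
        by blast
    qed simp
    finally show ?thesis .
  qed
  have "p \<in> borel_measurable N"
  proof (rule borel_measurableI)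
    fix S :: "'v set" assume "open S"
    show "p -` S \<inter> space N \<in> sets N"
    \<comment> \<open>The complement of \<open>S\<close> must be nonempty: \<open>infdist\<close> to
      the empty set is 0 by convention, so the criterion by distances would break down.\<close>
    proof (cases "S = UNIV")
      case False
      then have "p -` (- S) \<inter> space N \<in> sets N"
        using \<open>open S\<close> by (intro sets) auto
      then have "space N - (p -` (- S) \<inter> space N) \<in> sets N"
        by blast
      also have "space N - (p -` (- S) \<inter> space N) = p -` S \<inter> space N"
        by blast
      finally show ?thesis .
    qed simp
  qed
  then show ?thesis
    by (simp add: p_def[abs_def])
qed

text \<open>Each coordinate is a limit of difference quotients along an axis, which stay in the
  coordinate space as \<open>i\<close> lies in \<open>I\<close>. Only the pairing with
  \<open>\<mu>\<close> has to be measurable, which covers the cost with \<open>\<mu> = 1\<close> and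
  the dynamics with a random co-state.\<close>

lemma measurable_deriv_T:
  fixes \<phi> :: "'a \<Rightarrow> real ^ 'm::finite \<Rightarrow> 'b::real_inner"
  assumes u: "u \<in> N \<rightarrow>\<^sub>M coord_borel I"
    and diff: "\<And>\<omega>. \<omega> \<in> space N \<Longrightarrow> C1_on (coord_space I) (\<phi> \<omega>)"
    and meas: "\<And>v. v \<in> N \<rightarrow>\<^sub>M coord_borel I \<Longrightarrow> (\<lambda>\<omega>. inner (\<mu> \<omega>) (\<phi> \<omega> (v \<omega>))) \<in> borel_measurable N"
  shows "(\<lambda>\<omega>. deriv_T (coord_space I) (\<phi> \<omega>) (u \<omega>) (\<mu> \<omega>)) \<in> N \<rightarrow>\<^sub>M coord_borel I"
proof (rule measurable_coord_borelI)
  let ?V = "coord_space I"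
  have u_mem: "u \<omega> \<in> ?V" if "\<omega> \<in> space N" for \<omega>
    using u that by (simp add: measurable_coord_borel_iff)
  show "deriv_T ?V (\<phi> \<omega>) (u \<omega>) (\<mu> \<omega>) \<in> ?V" if "\<omega> \<in> space N" for \<omega>
    using C1_on_differentiable[OF diff[OF that] u_mem[OF that]]
      deriv_T_works(1)[OF subspace_coord_space u_mem[OF that]] by metis
  fix i assume "i \<in> I"
  then have ax: "axis i 1 \<in> ?V"
    by (auto simp: coord_space_def axis_def)
  define e where "e n = inverse (real (Suc n))" for n
  have e: "e n \<noteq> 0" for n
    by (simp add: e_def)
  have e_lim: "e \<longlonglongrightarrow> 0"
    unfolding e_def[abs_def] by (rule LIMSEQ_inverse_real_of_nat)
  let ?g = "\<lambda>\<omega> s. inner (\<mu> \<omega>) (\<phi> \<omega> (u \<omega> + s *\<^sub>R axis i 1))"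
  show "(\<lambda>\<omega>. deriv_T ?V (\<phi> \<omega>) (u \<omega>) (\<mu> \<omega>) $ i) \<in> borel_measurable N"
  proof (rule borel_measurable_LIMSEQ_real)
    fix \<omega> assume \<omega>: "\<omega> \<in> space N"
    obtain D where D: "(\<phi> \<omega> has_derivative D) (at (u \<omega>) within ?V)"
      using C1_on_differentiable[OF diff[OF \<omega>] u_mem[OF \<omega>]] by blast
    have "((\<lambda>z. inner (\<mu> \<omega>) (\<phi> \<omega> z)) has_derivative (\<lambda>k. inner (\<mu> \<omega>) (D k)))
        (at (u \<omega> + 0 *\<^sub>R axis i 1) within ?V)"
      using D by (auto intro!: derivative_eq_intros)
    from has_vector_derivative_along_line[OF subspace_coord_space u_mem[OF \<omega>] ax this]
    have "(?g \<omega> has_real_derivative inner (\<mu> \<omega>) (D (axis i 1))) (at 0)"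
      by (simp add: has_real_derivative_iff_has_vector_derivative)
    also have "inner (\<mu> \<omega>) (D (axis i 1)) = deriv_T ?V (\<phi> \<omega>) (u \<omega>) (\<mu> \<omega>) $ i"
      using deriv_T_works(2)[OF subspace_coord_space u_mem[OF \<omega>] D ax, of "\<mu> \<omega>"]
      by (simp add: inner_axis)
    finally have "((\<lambda>h. (?g \<omega> h - ?g \<omega> 0) / h) \<longlongrightarrow> deriv_T ?V (\<phi> \<omega>) (u \<omega>) (\<mu> \<omega>) $ i) (at 0)"
      by (simp add: DERIV_def)
    then show "(\<lambda>n. (?g \<omega> (e n) - ?g \<omega> 0) / e n) \<longlonglongrightarrow> deriv_T ?V (\<phi> \<omega>) (u \<omega>) (\<mu> \<omega>) $ i"
      by (rule filterlim_compose) (auto intro!: filterlim_atI e_lim simp: e)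
  next
    fix n
    have "(\<lambda>\<omega>. u \<omega> + s *\<^sub>R axis i 1) \<in> N \<rightarrow>\<^sub>M coord_borel I" for s
      using u ax by (auto simp: measurable_coord_borel_iff subspace_add[OF subspace_coord_space]
          subspace_scale[OF subspace_coord_space])
    note [measurable] = meas[OF this]
    show "(\<lambda>\<omega>. (?g \<omega> (e n) - ?g \<omega> 0) / e n) \<in> borel_measurable N"
      by measurable
  qed
qed

section \<open>Square integrable random vectors\<close>

lemma L2_D:
  assumes "u \<in> L2 M I"
  shows "u \<in> borel_measurable M" and "\<And>\<omega>. \<omega> \<in> space M \<Longrightarrow> u \<omega> \<in> coord_space I"
    and "integrable M (\<lambda>\<omega>. (norm (u \<omega>))\<^sup>2)"
  using assms by (auto simp: L2_def measurable_coord_borel_iff)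

lemma L2_I:
  assumes u: "u \<in> M \<rightarrow>\<^sub>M coord_borel I" and a: "integrable M a"
    and le: "AE \<omega> in M. (norm (u \<omega>))\<^sup>2 \<le> a \<omega>"
  shows "u \<in> L2 M I"
proof -
  have [measurable]: "u \<in> borel_measurable M"
    using u by (simp add: measurable_coord_borel_iff)
  have "integrable M (\<lambda>\<omega>. (norm (u \<omega>))\<^sup>2)"
    by (rule Bochner_Integration.integrable_bound[OF a]) (use le in auto)
  then show ?thesis
    using u by (simp add: L2_def)
qed

lemma L2_integrable_inner:
  assumes "u \<in> L2 M I" and "v \<in> L2 M I"
  shows "integrable M (\<lambda>\<omega>. inner (u \<omega>) (v \<omega>))"
proof -
  note [measurable] = L2_D(1)[OF assms(1)] L2_D(1)[OF assms(2)]
  have "norm (inner (u \<omega>) (v \<omega>)) \<le> norm ((norm (u \<omega>))\<^sup>2 + (norm (v \<omega>))\<^sup>2)" for \<omega>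
  proof -
    have "\<bar>inner (u \<omega>) (v \<omega>)\<bar> \<le> norm (u \<omega>) * norm (v \<omega>)"
      by (rule Cauchy_Schwarz_ineq2)
    also have "\<dots> \<le> (norm (u \<omega>))\<^sup>2 + (norm (v \<omega>))\<^sup>2"
      using sum_squares_bound[of "norm (u \<omega>)" "norm (v \<omega>)"]
        mult_nonneg_nonneg[OF norm_ge_zero[of "u \<omega>"] norm_ge_zero[of "v \<omega>"]] by linarith
    finally show ?thesis
      by simp
  qed
  then show ?thesis
    by (intro Bochner_Integration.integrable_bound[OF
          Bochner_Integration.integrable_add[OF L2_D(3)[OF assms(1)] L2_D(3)[OF assms(2)]]]) auto
qed

text \<open>The scalar may be random: besides differences, this covers perturbed controls whose step
  length depends on the outcome.\<close>

lemma L2_add_scaled: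
  assumes u: "u \<in> L2 M I" and v: "v \<in> L2 M I"
    and \<sigma>: "\<sigma> \<in> borel_measurable M" "\<And>\<omega>. \<bar>\<sigma> \<omega>\<bar> \<le> 1"
  shows "(\<lambda>\<omega>. u \<omega> + \<sigma> \<omega> *\<^sub>R v \<omega>) \<in> L2 M I"
proof (rule L2_I)
  note [measurable] = L2_D(1)[OF u] L2_D(1)[OF v] \<sigma>(1)
  show "(\<lambda>\<omega>. u \<omega> + \<sigma> \<omega> *\<^sub>R v \<omega>) \<in> M \<rightarrow>\<^sub>M coord_borel I"
    using L2_D(2)[OF u] L2_D(2)[OF v] unfolding measurable_coord_borel_iff
    by (auto intro!: subspace_add subspace_scale subspace_coord_space)
  show "integrable M (\<lambda>\<omega>. 2 * (norm (u \<omega>))\<^sup>2 + 2 * (norm (v \<omega>))\<^sup>2)"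
    using L2_D(3)[OF u] L2_D(3)[OF v] by simp
  have "(norm (u \<omega> + \<sigma> \<omega> *\<^sub>R v \<omega>))\<^sup>2 \<le> 2 * (norm (u \<omega>))\<^sup>2 + 2 * (norm (v \<omega>))\<^sup>2" for \<omega>
  proof -
    have "norm (\<sigma> \<omega> *\<^sub>R v \<omega>) \<le> norm (v \<omega>)"
      using mult_right_mono[OF \<sigma>(2)[of \<omega>], of "norm (v \<omega>)"] by simp
    then have "norm (u \<omega> + \<sigma> \<omega> *\<^sub>R v \<omega>) \<le> norm (u \<omega>) + norm (v \<omega>)"
      using norm_triangle_ineq[of "u \<omega>" "\<sigma> \<omega> *\<^sub>R v \<omega>"] by linarith
    then have "(norm (u \<omega> + \<sigma> \<omega> *\<^sub>R v \<omega>))\<^sup>2 \<le> (norm (u \<omega>) + norm (v \<omega>))\<^sup>2"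
      by (rule power_mono) simp
    also have "\<dots> \<le> 2 * (norm (u \<omega>))\<^sup>2 + 2 * (norm (v \<omega>))\<^sup>2"
      using sum_squares_bound[of "norm (u \<omega>)" "norm (v \<omega>)"] by (simp add: power2_sum)
    finally show ?thesis .
  qed
  then show "AE \<omega> in M. (norm (u \<omega> + \<sigma> \<omega> *\<^sub>R v \<omega>))\<^sup>2 \<le> 2 * (norm (u \<omega>))\<^sup>2 + 2 * (norm (v \<omega>))\<^sup>2"
    by simp
qed

lemma L2_diff:
  assumes "u \<in> L2 M I" and "v \<in> L2 M I"
  shows "(\<lambda>\<omega>. u \<omega> - v \<omega>) \<in> L2 M I"
  using L2_add_scaled[OF assms, of "\<lambda>_. - 1"] by simp

section \<open>Differentiation under the integral\<close>

text \<open>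
  The integrability hypothesis at \<^emph>\<open>measurable\<close> \<open>\<sigma>\<close> supplies the dominating function for
  differentiation under the integral: choose \<open>\<sigma> \<omega>\<close> to maximise \<open>\<bar>F' \<omega> s\<bar>\<close> over \<open>s \<in> [0, 1]\<close> up to \<open>1\<close>.
\<close>

lemma integral_derivative_nonneg:
  fixes F F' :: "'a \<Rightarrow> real \<Rightarrow> real"
  assumes "finite_measure M"
    and deriv: "\<And>\<omega> s. \<omega> \<in> space M \<Longrightarrow> (F \<omega> has_real_derivative F' \<omega> s) (at s)"
    and cont: "\<And>\<omega>. \<omega> \<in> space M \<Longrightarrow> continuous_on UNIV (F' \<omega>)"
    and F'_int: "\<And>\<sigma>. \<sigma> \<in> borel_measurable M \<Longrightarrow> (\<And>\<omega>. \<sigma> \<omega> \<in> {0..1}) \<Longrightarrow> integrable M (\<lambda>\<omega>. F' \<omega> (\<sigma> \<omega>))"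
    and F_int: "\<And>s. s \<in> {0..1} \<Longrightarrow> integrable M (\<lambda>\<omega>. F \<omega> s)"
    and min: "\<And>s. s \<in> {0..1} \<Longrightarrow> (\<integral>\<omega>. F \<omega> 0 \<partial>M) \<le> (\<integral>\<omega>. F \<omega> s \<partial>M)"
  shows "0 \<le> (\<integral>\<omega>. F' \<omega> 0 \<partial>M)"
proof -
  interpret finite_measure M by fact
  define clip :: "real \<Rightarrow> real" where "clip s = max 0 (min 1 s)" for s
  have clip: "clip s \<in> {0..1}" for s
    by (auto simp: clip_def)
  have clip_id: "s \<in> {0..1} \<Longrightarrow> clip s = s" for s
    by (auto simp: clip_def)
  \<comment> \<open>A countable dense family in the unit interval, so that near-maximality can be
    expressed by countably many measurable conditions.\<close>
  define r where "r n = clip (from_nat_into \<rat> n)" for n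
  have r: "r n \<in> {0..1}" for n
    by (simp only: r_def clip)
  have F'_meas [measurable]: "(\<lambda>\<omega>. F' \<omega> (r n)) \<in> borel_measurable M" for n
    by (rule borel_measurable_integrable[OF F'_int[of "\<lambda>_. r n", OF borel_measurable_const r]])
  \<comment> \<open>Taking the least index makes the choice measurable. The slack 1 is there because
    the supremum over a countable family need not be attained.\<close>
  define k where "k \<omega> = (LEAST n. \<forall>m. \<bar>F' \<omega> (r m)\<bar> \<le> \<bar>F' \<omega> (r n)\<bar> + 1)" for \<omega>
  have [measurable]: "k \<in> M \<rightarrow>\<^sub>M count_space UNIV"
    unfolding k_def[abs_def] by measurable
  define B where "B \<omega> = \<bar>F' \<omega> (r (k \<omega>))\<bar> + 1" for \<omega>
  have "integrable M (\<lambda>\<omega>. F' \<omega> (r (k \<omega>)))"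
  proof (rule F'_int)
    show "(\<lambda>\<omega>. r (k \<omega>)) \<in> borel_measurable M"
      by (rule measurable_compose[of k M "count_space UNIV"]) auto
  qed (rule r)
  then have B_int: "integrable M B"
    unfolding B_def[abs_def] by simp
  have bound: "\<bar>F' \<omega> s\<bar> \<le> B \<omega>" if \<omega>: "\<omega> \<in> space M" and s: "s \<in> {0..1}" for \<omega> s
  proof -
    let ?A = "range (\<lambda>m. \<bar>F' \<omega> (r m)\<bar>)"
    have "bounded (F' \<omega> ` {0..1})"
      by (intro compact_imp_bounded compact_continuous_image continuous_on_subset[OF cont[OF \<omega>]]) auto
    then obtain b where "\<forall>x\<in>{0..1}. \<bar>F' \<omega> x\<bar> \<le> b"
      by (auto simp: bounded_iff)
    then have bdd: "bdd_above ?A"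
      using r by (intro bdd_aboveI[of _ b]) blast
    obtain n where n: "Sup ?A - 1 < \<bar>F' \<omega> (r n)\<bar>"
      using less_cSupE[of "Sup ?A - 1" ?A] by auto
    have "\<forall>m. \<bar>F' \<omega> (r m)\<bar> \<le> \<bar>F' \<omega> (r n)\<bar> + 1"
    proof
      fix m
      have "\<bar>F' \<omega> (r m)\<bar> \<le> Sup ?A"
        by (rule cSup_upper[OF rangeI bdd])
      with n show "\<bar>F' \<omega> (r m)\<bar> \<le> \<bar>F' \<omega> (r n)\<bar> + 1"
        by linarith
    qed
    then have rat: "\<bar>F' \<omega> (r m)\<bar> \<le> B \<omega>" for m
      unfolding B_def k_def by (rule LeastI2) blast
    \<comment> \<open>The bound holds at the clipped rationals. Composition with \<open>clip\<close>
      gives a continuous function on the whole line, so density of the rationals carries the bound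
      to every \<open>s\<close>.\<close>
    have "continuous_on UNIV (\<lambda>s. F' \<omega> (clip s))"
      unfolding clip_def by (intro continuous_on_compose2[OF cont[OF \<omega>]] continuous_intros) auto
    moreover have "\<forall>q\<in>\<rat>. norm (F' \<omega> (clip q)) \<le> B \<omega>"
    proof
      fix q :: real assume "q \<in> \<rat>"
      then obtain m where "from_nat_into \<rat> m = q"
        using from_nat_into_surj[OF countable_rat] by blast
      then show "norm (F' \<omega> (clip q)) \<le> B \<omega>"
        using rat[of m] by (simp add: r_def)
    qed
    ultimately have "norm (F' \<omega> (clip s)) \<le> B \<omega>"
      by (intro continuous_on_closure_norm_le[where s = \<rat>]) (simp_all add: Rats_closure_real)
    then show ?thesis
      by (simp only: clip_id[OF s] real_norm_def)
  qed
  define e where "e n = inverse (real (Suc n))" for n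
  have e: "e n > 0" "e n \<in> {0..1}" for n
    by (auto simp: e_def divide_simps)
  have e_lim: "e \<longlonglongrightarrow> 0"
    unfolding e_def[abs_def] by (rule LIMSEQ_inverse_real_of_nat)
  let ?Q = "\<lambda>n \<omega>. (F \<omega> (e n) - F \<omega> 0) / e n"
  have F_int0: "integrable M (\<lambda>\<omega>. F \<omega> 0)"
    by (rule F_int) simp
  have Q_int: "integrable M (?Q n)" for n
    using F_int[OF e(2), of n] F_int0 by simp
  have "(\<lambda>n. \<integral>\<omega>. ?Q n \<omega> \<partial>M) \<longlonglongrightarrow> (\<integral>\<omega>. F' \<omega> 0 \<partial>M)"
  proof (rule integral_dominated_convergence[where w = B])
    show "(\<lambda>\<omega>. F' \<omega> 0) \<in> borel_measurable M"
      by (rule borel_measurable_integrable[OF F'_int[of "\<lambda>_. 0"]]) auto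
    show "?Q n \<in> borel_measurable M" for n
      by (rule borel_measurable_integrable[OF Q_int])
    show "AE \<omega> in M. (\<lambda>n. ?Q n \<omega>) \<longlonglongrightarrow> F' \<omega> 0"
    proof (rule AE_I2)
      fix \<omega> assume \<omega>: "\<omega> \<in> space M"
      have "((\<lambda>h. (F \<omega> h - F \<omega> 0) / h) \<longlongrightarrow> F' \<omega> 0) (at 0)"
        using deriv[OF \<omega>, of 0] by (simp add: DERIV_def)
      then show "(\<lambda>n. ?Q n \<omega>) \<longlonglongrightarrow> F' \<omega> 0"
        by (rule filterlim_compose) (use e in \<open>auto intro!: filterlim_atI e_lim simp: less_imp_neq[symmetric]\<close>)
    qed
    show "AE \<omega> in M. norm (?Q n \<omega>) \<le> B \<omega>" for n
    proof (rule AE_I2)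
      fix \<omega> assume \<omega>: "\<omega> \<in> space M"
      \<comment> \<open>By the mean value theorem the difference quotient is a value of the
        derivative at a point of the unit interval, where \<open>B\<close> dominates.\<close>
      obtain \<theta> where \<theta>: "0 < \<theta>" "\<theta> < e n" "F \<omega> (e n) - F \<omega> 0 = (e n - 0) * F' \<omega> \<theta>"
        using MVT2[OF e(1)[of n], of "F \<omega>" "F' \<omega>"] deriv[OF \<omega>] by blast
      then have "?Q n \<omega> = F' \<omega> \<theta>"
        using e(1)[of n] by simp
      then show "norm (?Q n \<omega>) \<le> B \<omega>"
        using bound[OF \<omega>, of \<theta>] \<theta> e(2)[of n] by simp
    qed
  qed (fact B_int)
  moreover have "0 \<le> (\<integral>\<omega>. ?Q n \<omega> \<partial>M)" for n
    using min[OF e(2)[of n]] F_int[OF e(2)[of n]] F_int0 e(1)[of n] by simp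
  ultimately show ?thesis
    by (intro LIMSEQ_le_const) auto
qed

section \<open>Conditional expectation and projection\<close>

lemma measurable_coord_borel_subalgebra:
  assumes "subalgebra M G" and "v \<in> G \<rightarrow>\<^sub>M coord_borel I"
  shows "v \<in> M \<rightarrow>\<^sub>M coord_borel I"
  using assms measurable_from_subalg by blast

lemma measurable_vec_cond_exp: "vec_cond_exp M G I g \<in> G \<rightarrow>\<^sub>M coord_borel I"
  by (rule measurable_coord_borelI) (auto simp: vec_cond_exp_def coord_space_def)

lemma norm_vec_power2: "(norm (v :: real ^ 'n::finite))\<^sup>2 = (\<Sum>i\<in>UNIV. (v $ i)\<^sup>2)"
  unfolding power2_norm_eq_inner inner_vec_def by (simp add: power2_eq_square)

lemma L2_component:
  assumes "u \<in> L2 M I"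
  shows "integrable M (\<lambda>\<omega>. (u \<omega> $ i)\<^sup>2)"
proof (rule Bochner_Integration.integrable_bound[OF L2_D(3)[OF assms]])
  note [measurable] = L2_D(1)[OF assms]
  have [measurable]: "(\<lambda>\<omega>. u \<omega> $ i) \<in> borel_measurable M"
    by (simp add: cart_eq_inner_axis)
  show "(\<lambda>\<omega>. (u \<omega> $ i)\<^sup>2) \<in> borel_measurable M"
    by measurable
  show "AE \<omega> in M. norm ((u \<omega> $ i)\<^sup>2) \<le> norm ((norm (u \<omega>))\<^sup>2)"
  proof (rule AE_I2)
    show "norm ((u \<omega> $ i)\<^sup>2) \<le> norm ((norm (u \<omega>))\<^sup>2)" for \<omega>
      using component_le_norm_cart[of "u \<omega>" i] abs_le_square_iff[of "u \<omega> $ i" "norm (u \<omega>)"] by simp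
  qed
qed

lemma controls_meI:
  assumes "u \<in> L2 M I" and "v \<in> G \<rightarrow>\<^sub>M coord_borel I" and "AE \<omega> in M. u \<omega> = v \<omega>"
  shows "u \<in> controls_me M I G"
  using assms unfolding controls_me_def by blast

lemma controls_me_diff:
  assumes "u \<in> controls_me M I G" and "v \<in> controls_me M I G"
  shows "(\<lambda>\<omega>. u \<omega> - v \<omega>) \<in> controls_me M I G"
proof -
  obtain u' v' where uv: "u' \<in> G \<rightarrow>\<^sub>M coord_borel I" "AE \<omega> in M. u \<omega> = u' \<omega>"
      "v' \<in> G \<rightarrow>\<^sub>M coord_borel I" "AE \<omega> in M. v \<omega> = v' \<omega>"
    using assms unfolding controls_me_def by blast
  show ?thesis
  proof (rule controls_meI)
    show "(\<lambda>\<omega>. u \<omega> - v \<omega>) \<in> L2 M I"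
      using assms by (intro L2_diff) (simp_all add: controls_me_def)
    show "(\<lambda>\<omega>. u' \<omega> - v' \<omega>) \<in> G \<rightarrow>\<^sub>M coord_borel I"
      using uv(1,3) by (auto simp: measurable_coord_borel_iff subspace_diff[OF subspace_coord_space])
    show "AE \<omega> in M. u \<omega> - v \<omega> = u' \<omega> - v' \<omega>"
      using uv(2,4) by eventually_elim simp
  qed
qed

context
  fixes M G :: "'a measure"
  assumes prob: "prob_space M" and sub: "subalgebra M G"
begin

interpretation prob_space M by (fact prob)
interpretation finite_measure_subalgebra M G by (standard, fact sub)

lemma L2_component_integrable:
  assumes "u \<in> L2 M I"
  shows "integrable M (\<lambda>\<omega>. u \<omega> $ i)"
proof (rule square_integrable_imp_integrable[OF _ L2_component[OF assms]])
  show "(\<lambda>\<omega>. u \<omega> $ i) \<in> borel_measurable M"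
    using L2_D(1)[OF assms] by (simp add: cart_eq_inner_axis)
qed

text \<open>Conditional Jensen inequality for the square, applied to each component.\<close>

lemma vec_cond_exp_L2:
  assumes "g \<in> L2 M I"
  shows "vec_cond_exp M G I g \<in> L2 M I"
proof -
  have "integrable M (\<lambda>\<omega>. (vec_cond_exp M G I g \<omega> $ i)\<^sup>2)" for i
  proof (cases "i \<in> I")
    case True
    show ?thesis
      using integrable_convex_cond_exp[OF L2_component_integrable[OF assms], where I = UNIV,
          OF _ _ L2_component[OF assms] convex_power2] True
      by (simp add: vec_cond_exp_def)
  qed (simp add: vec_cond_exp_def)
  then show ?thesis
    using measurable_coord_borel_subalgebra[OF sub measurable_vec_cond_exp]
    by (simp add: L2_def norm_vec_power2)
qed

text \<open>Componentwise, a \<open>G\<close>-measurable factor can be pulled out of the conditional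
  expectation. Coordinates outside \<open>I\<close> contribute nothing on either side, by the
  definition of \<open>vec_cond_exp\<close> and since \<open>v\<close> vanishes there.\<close>

lemma integral_inner_vec_cond_exp:
  assumes g: "g \<in> L2 M I" and v: "v \<in> L2 M I" "v \<in> G \<rightarrow>\<^sub>M coord_borel I"
  shows "(\<integral>\<omega>. inner (vec_cond_exp M G I g \<omega>) (v \<omega>) \<partial>M) = (\<integral>\<omega>. inner (g \<omega>) (v \<omega>) \<partial>M)"
proof -
  have prod: "integrable M (\<lambda>\<omega>. v \<omega> $ i * g \<omega> $ i)" for i
  proof (rule Bochner_Integration.integrable_bound[OF
        Bochner_Integration.integrable_add[OF L2_component[OF g, of i] L2_component[OF v(1), of i]]])
    show "(\<lambda>\<omega>. v \<omega> $ i * g \<omega> $ i) \<in> borel_measurable M"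
      using L2_D(1)[OF g] L2_D(1)[OF v(1)] by (simp add: cart_eq_inner_axis)
    show "AE \<omega> in M. norm (v \<omega> $ i * g \<omega> $ i) \<le> norm ((g \<omega> $ i)\<^sup>2 + (v \<omega> $ i)\<^sup>2)"
    proof (rule AE_I2)
      fix \<omega>
      show "norm (v \<omega> $ i * g \<omega> $ i) \<le> norm ((g \<omega> $ i)\<^sup>2 + (v \<omega> $ i)\<^sup>2)"
        using sum_squares_bound[of "\<bar>v \<omega> $ i\<bar>" "\<bar>g \<omega> $ i\<bar>"]
          abs_ge_zero[of "v \<omega> $ i * g \<omega> $ i"] unfolding abs_mult real_norm_def power2_abs
        by (intro order_trans[OF _ abs_ge_self]) linarith
    qed
  qed
  have v_zero: "v \<omega> $ i = 0" if "\<omega> \<in> space M" "i \<notin> I" for \<omega> i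
    using L2_D(2)[OF v(1) that(1)] that(2) by (simp add: coord_space_def)
  have vG: "(\<lambda>\<omega>. v \<omega> $ i) \<in> borel_measurable G" and gM: "(\<lambda>\<omega>. g \<omega> $ i) \<in> borel_measurable M" for i
    using v(2) L2_D(1)[OF g] by (auto simp: measurable_coord_borel_iff cart_eq_inner_axis)
  have "(\<integral>\<omega>. inner (vec_cond_exp M G I g \<omega>) (v \<omega>) \<partial>M)
      = (\<integral>\<omega>. (\<Sum>i\<in>I. v \<omega> $ i * real_cond_exp M G (\<lambda>\<omega>. g \<omega> $ i) \<omega>) \<partial>M)"
    by (intro Bochner_Integration.integral_cong refl)
      (auto simp: inner_vec_def vec_cond_exp_def intro!: sum.mono_neutral_cong_right)
  also have "\<dots> = (\<Sum>i\<in>I. \<integral>\<omega>. v \<omega> $ i * g \<omega> $ i \<partial>M)"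
    using real_cond_exp_intg[OF prod vG gM] by simp
  also have "\<dots> = (\<integral>\<omega>. (\<Sum>i\<in>I. v \<omega> $ i * g \<omega> $ i) \<partial>M)"
    using prod by simp
  also have "\<dots> = (\<integral>\<omega>. inner (g \<omega>) (v \<omega>) \<partial>M)"
    using v_zero
    by (intro Bochner_Integration.integral_cong refl)
      (auto simp: inner_vec_def mult.commute intro!: sum.mono_neutral_left)
  finally show ?thesis .
qed

lemma integral_inner_vec_cond_exp_controls_me:
  assumes g: "g \<in> L2 M I" and v: "v \<in> controls_me M I G"
  shows "(\<integral>\<omega>. inner (vec_cond_exp M G I g \<omega>) (v \<omega>) \<partial>M) = (\<integral>\<omega>. inner (g \<omega>) (v \<omega>) \<partial>M)"
proof -
  obtain v' where v': "v' \<in> G \<rightarrow>\<^sub>M coord_borel I" "AE \<omega> in M. v \<omega> = v' \<omega>" and vL: "v \<in> L2 M I"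
    using v unfolding controls_me_def by blast
  have "AE \<omega> in M. (norm (v' \<omega>))\<^sup>2 \<le> (norm (v \<omega>))\<^sup>2"
    using v'(2) by eventually_elim simp
  then have v'L: "v' \<in> L2 M I"
    by (rule L2_I[OF measurable_coord_borel_subalgebra[OF sub v'(1)] L2_D(3)[OF vL]])
  have eq: "(\<integral>\<omega>. inner (p \<omega>) (v \<omega>) \<partial>M) = (\<integral>\<omega>. inner (p \<omega>) (v' \<omega>) \<partial>M)" if p: "p \<in> L2 M I" for p
  proof (rule integral_cong_AE)
    show "AE \<omega> in M. inner (p \<omega>) (v \<omega>) = inner (p \<omega>) (v' \<omega>)"
      using v'(2) by eventually_elim simp
  qed (use L2_D(1)[OF p] L2_D(1)[OF vL] L2_D(1)[OF v'L] in measurable)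
  show ?thesis
    unfolding eq[OF g] eq[OF vec_cond_exp_L2[OF g]]
    by (rule integral_inner_vec_cond_exp[OF g v'L v'(1)])
qed

text \<open>
  Testing the variational inequality against the projection \<open>v\<close> of \<open>u - r\<close> onto \<open>\<Gamma>\<close>, which is again
  \<open>G\<close>-measurable, forces \<open>v = u\<close> almost surely, so that \<open>- r\<close> is pointwise normal to \<open>\<Gamma>\<close> at \<open>u\<close>.
\<close>

lemma variational_inequality_pointwise:
  assumes \<Gamma>: "measurable_setmap G \<Gamma>"
    and cl: "\<And>\<omega>. \<omega> \<in> space M \<Longrightarrow> closed (\<Gamma> \<omega>)" and co: "\<And>\<omega>. \<omega> \<in> space M \<Longrightarrow> convex (\<Gamma> \<omega>)"
    and range: "\<And>\<omega>. \<omega> \<in> space M \<Longrightarrow> \<Gamma> \<omega> \<subseteq> coord_space I"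
    and u: "u \<in> controls_as M I \<Gamma> \<inter> controls_me M I G"
    and r: "r \<in> L2 M I" "r \<in> G \<rightarrow>\<^sub>M coord_borel I"
    and ineq: "\<And>v. v \<in> controls_as M I \<Gamma> \<inter> controls_me M I G \<Longrightarrow> 0 \<le> (\<integral>\<omega>. inner (r \<omega>) (v \<omega> - u \<omega>) \<partial>M)"
  shows "AE \<omega> in M. \<forall>y\<in>\<Gamma> \<omega>. 0 \<le> inner (r \<omega>) (y - u \<omega>)"
proof -
  obtain u' where u': "u' \<in> G \<rightarrow>\<^sub>M coord_borel I" "AE \<omega> in M. u \<omega> = u' \<omega>"
    using u unfolding controls_me_def by blast
  have uL: "u \<in> L2 M I" and u\<Gamma>: "AE \<omega> in M. u \<omega> \<in> \<Gamma> \<omega>"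
    using u unfolding controls_as_def by blast+
  have spG: "space G = space M"
    using sub by (simp add: subalgebra_def)
  \<comment> \<open>The projection needs nonempty values at every outcome. The event where
    \<open>\<Gamma>\<close> is empty is in \<open>G\<close> and null because \<open>u\<close> lies
    in \<open>\<Gamma>\<close> almost surely; the value \<open>{0}\<close> is closed, convex and
    inside the coordinate space.\<close>
  define \<Delta> where "\<Delta> \<omega> = (if \<Gamma> \<omega> = {} then {0} else \<Gamma> \<omega>)" for \<omega>
  have \<Delta>: "measurable_setmap G \<Delta>"
    unfolding measurable_setmap_def
  proof (intro allI impI)
    fix S :: "(real ^ 'b) set" assume S: "open S"
    have *: "{\<omega> \<in> space G. \<Gamma> \<omega> \<inter> S \<noteq> {}} \<in> sets G" "{\<omega> \<in> space G. \<Gamma> \<omega> \<inter> UNIV \<noteq> {}} \<in> sets G"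
      using \<Gamma> S open_UNIV unfolding measurable_setmap_def by blast+
    have "{\<omega> \<in> space G. \<Delta> \<omega> \<inter> S \<noteq> {}} = {\<omega> \<in> space G. \<Gamma> \<omega> \<inter> S \<noteq> {}} \<union>
        (if 0 \<in> S then space G - {\<omega> \<in> space G. \<Gamma> \<omega> \<inter> UNIV \<noteq> {}} else {})"
      by (auto simp: \<Delta>_def)
    with * show "{\<omega> \<in> space G. \<Delta> \<omega> \<inter> S \<noteq> {}} \<in> sets G"
      by auto
  qed
  \<comment> \<open>The representative \<open>u'\<close> is projected because \<open>u\<close>
    itself is \<open>G\<close>-measurable only up to a null set.\<close>
  define v where "v \<omega> = closest_point (\<Delta> \<omega>) (u' \<omega> - r \<omega>)" for \<omega>
  have "(\<lambda>\<omega>. u' \<omega> - r \<omega>) \<in> borel_measurable G"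
    using u'(1) r(2) by (auto simp: measurable_coord_borel_iff)
  then have "v \<in> borel_measurable G"
    unfolding v_def[abs_def]
    by (rule borel_measurable_closest_point[OF \<Delta>, rotated -1])
      (simp_all add: \<Delta>_def spG cl co)
  moreover have "v \<omega> \<in> \<Delta> \<omega>" if "\<omega> \<in> space M" for \<omega>
    unfolding v_def using cl[OF that] by (intro closest_point_in_set) (auto simp: \<Delta>_def)
  then have "v \<omega> \<in> coord_space I" if "\<omega> \<in> space M" for \<omega>
    using range[OF that] that subspace_0[OF subspace_coord_space[of I]]
    by (force simp: \<Delta>_def split: if_splits)
  ultimately have vG: "v \<in> G \<rightarrow>\<^sub>M coord_borel I"
    by (simp add: measurable_coord_borel_iff spG)
  have key: "AE \<omega> in M. v \<omega> \<in> \<Gamma> \<omega> \<and> (\<forall>y\<in>\<Gamma> \<omega>. inner (u \<omega> - r \<omega> - v \<omega>) (y - v \<omega>) \<le> 0)"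
    using u'(2) u\<Gamma> AE_space
  proof eventually_elim
    case (elim \<omega>)
    then have "\<Delta> \<omega> = \<Gamma> \<omega>" "\<Gamma> \<omega> \<noteq> {}"
      by (auto simp: \<Delta>_def)
    then show ?case
      using closest_point_in_set[OF cl[OF elim(3)], of "u \<omega> - r \<omega>"]
        closest_point_dot[OF co[OF elim(3)] cl[OF elim(3)], of _ "u \<omega> - r \<omega>"] elim(1)
      by (simp add: v_def)
  qed
  \<comment> \<open>Choosing \<open>y = u \<omega>\<close> in the angle condition of the projection.
    The estimate first bounds \<open>v - u\<close> by \<open>r\<close>, hence gives square
    integrability, and then contradicts the variational inequality unless
    \<open>v = u\<close>.\<close>
  have sq: "AE \<omega> in M. (norm (v \<omega> - u \<omega>))\<^sup>2 \<le> - inner (r \<omega>) (v \<omega> - u \<omega>)"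
    using key u\<Gamma>
  proof eventually_elim
    case (elim \<omega>)
    then have "inner (u \<omega> - r \<omega> - v \<omega>) (u \<omega> - v \<omega>) \<le> 0"
      by blast
    then show ?case
      by (simp add: power2_norm_eq_inner inner_diff_left inner_diff_right inner_commute algebra_simps)
  qed
  have vM: "v \<in> M \<rightarrow>\<^sub>M coord_borel I"
    by (rule measurable_coord_borel_subalgebra[OF sub vG])
  have vuL: "(\<lambda>\<omega>. v \<omega> - u \<omega>) \<in> L2 M I"
  proof (rule L2_I[OF _ L2_D(3)[OF r(1)]])
    show "(\<lambda>\<omega>. v \<omega> - u \<omega>) \<in> M \<rightarrow>\<^sub>M coord_borel I"
      using vM L2_D(1,2)[OF uL] by (auto simp: measurable_coord_borel_iff subspace_diff[OF subspace_coord_space])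
    show "AE \<omega> in M. (norm (v \<omega> - u \<omega>))\<^sup>2 \<le> (norm (r \<omega>))\<^sup>2"
      using sq
    proof eventually_elim
      case (elim \<omega>)
      also have "- inner (r \<omega>) (v \<omega> - u \<omega>) \<le> norm (r \<omega>) * norm (v \<omega> - u \<omega>)"
        using Cauchy_Schwarz_ineq2[of "r \<omega>" "v \<omega> - u \<omega>"] by linarith
      finally have "norm (v \<omega> - u \<omega>) \<le> norm (r \<omega>)"
        by (cases "norm (v \<omega> - u \<omega>) = 0") (auto simp: power2_eq_square mult_le_cancel_right)
      then show ?case
        by (rule power_mono) simp
    qed
  qed
  then have "v \<in> L2 M I"
    using L2_add_scaled[OF uL vuL, of "\<lambda>_. 1"] by simp
  then have "0 \<le> (\<integral>\<omega>. inner (r \<omega>) (v \<omega> - u \<omega>) \<partial>M)"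
    using vG key by (intro ineq) (auto simp: controls_as_def controls_me_def)
  moreover have "(\<integral>\<omega>. (norm (v \<omega> - u \<omega>))\<^sup>2 \<partial>M) \<le> (\<integral>\<omega>. - inner (r \<omega>) (v \<omega> - u \<omega>) \<partial>M)"
    using L2_integrable_inner[OF r(1) vuL] by (intro integral_mono_AE L2_D(3)[OF vuL] sq) auto
  moreover have "0 \<le> (\<integral>\<omega>. (norm (v \<omega> - u \<omega>))\<^sup>2 \<partial>M)"
    by simp
  ultimately have "(\<integral>\<omega>. (norm (v \<omega> - u \<omega>))\<^sup>2 \<partial>M) = 0"
    unfolding Bochner_Integration.integral_minus by linarith
  then have "AE \<omega> in M. (norm (v \<omega> - u \<omega>))\<^sup>2 = 0"
    using integral_nonneg_eq_0_iff_AE[OF L2_D(3)[OF vuL]] by simp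
  \<comment> \<open>With \<open>v = u\<close> the angle condition in \<open>key\<close> becomes
    \<open>inner (- r \<omega>) (y - u \<omega>) \<le> 0\<close>.\<close>
  with key show ?thesis
    by eventually_elim simp
qed

end

section \<open>The optimality system\<close>

lemma subalgebra_vimage_algebra:
  assumes "y \<in> borel_measurable M"
  shows "subalgebra M (vimage_algebra (space M) y borel)"
  unfolding subalgebra_def using measurable_sets[OF assms]
  by (auto simp: sets_vimage_algebra2)

lemma measurable_stage_cost:
  fixes a :: "'a \<Rightarrow> real ^ 'n::finite" and b :: "'a \<Rightarrow> real ^ 'm::finite"
  assumes "normal_integrand (coord_borel IC) (coord_space IA \<times> coord_space IB) (\<lambda>c (a, b). \<phi> a b c)"
    and a: "a \<in> N \<rightarrow>\<^sub>M coord_borel IA" and b: "b \<in> N \<rightarrow>\<^sub>M coord_borel IB" and c: "c \<in> N \<rightarrow>\<^sub>M coord_borel IC"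
  shows "(\<lambda>\<omega>. \<phi> (a \<omega>) (b \<omega>) (c \<omega>)) \<in> borel_measurable N"
proof -
  have "(\<lambda>\<omega>. (a \<omega>, b \<omega>)) \<in> borel_measurable N"
    using a b by (auto simp: measurable_coord_borel_iff)
  from normal_integrand_measurable[OF assms(1) c this] show ?thesis
    using a b by (simp add: measurable_coord_borel_iff)
qed

lemma measurable_stage_dynamics:
  fixes a :: "'a \<Rightarrow> real ^ 'n::finite" and b :: "'a \<Rightarrow> real ^ 'm::finite"
  assumes normal: "\<And>i. i \<in> ID \<Longrightarrow>
        normal_integrand (coord_borel IC) (coord_space IA \<times> coord_space IB) (\<lambda>c (a, b). \<phi> a b c $ i)"
    and range: "\<And>a b c. a \<in> coord_space IA \<Longrightarrow> b \<in> coord_space IB \<Longrightarrow> c \<in> coord_space IC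
        \<Longrightarrow> \<phi> a b c \<in> coord_space ID"
    and abc: "a \<in> N \<rightarrow>\<^sub>M coord_borel IA" "b \<in> N \<rightarrow>\<^sub>M coord_borel IB" "c \<in> N \<rightarrow>\<^sub>M coord_borel IC"
  shows "(\<lambda>\<omega>. \<phi> (a \<omega>) (b \<omega>) (c \<omega>)) \<in> N \<rightarrow>\<^sub>M coord_borel ID"
proof (rule measurable_coord_borelI)
  show "(\<lambda>\<omega>. \<phi> (a \<omega>) (b \<omega>) (c \<omega>) $ i) \<in> borel_measurable N" if "i \<in> ID" for i
    by (rule measurable_stage_cost[OF normal[OF that] abc])
  show "\<phi> (a \<omega>) (b \<omega>) (c \<omega>) \<in> coord_space ID" if "\<omega> \<in> space N" for \<omega>
    using abc that by (intro range) (simp_all add: measurable_coord_borel_iff)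
qed

lemma controls_segment:
  assumes u: "u \<in> controls_as M I \<Gamma> \<inter> controls_me M I G"
    and v: "v \<in> controls_as M I \<Gamma> \<inter> controls_me M I G"
    and co: "\<And>\<omega>. \<omega> \<in> space M \<Longrightarrow> convex (\<Gamma> \<omega>)" and s: "s \<in> {0..1::real}"
  shows "(\<lambda>\<omega>. u \<omega> + s *\<^sub>R (v \<omega> - u \<omega>)) \<in> controls_as M I \<Gamma> \<inter> controls_me M I G"
proof -
  obtain u' v' where uv: "u' \<in> G \<rightarrow>\<^sub>M coord_borel I" "AE \<omega> in M. u \<omega> = u' \<omega>"
      "v' \<in> G \<rightarrow>\<^sub>M coord_borel I" "AE \<omega> in M. v \<omega> = v' \<omega>"
    using u v unfolding controls_me_def by blast
  have \<Gamma>: "AE \<omega> in M. u \<omega> \<in> \<Gamma> \<omega>" "AE \<omega> in M. v \<omega> \<in> \<Gamma> \<omega>" and L: "u \<in> L2 M I" "v \<in> L2 M I"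
    using u v unfolding controls_as_def by blast+
  have inL2: "(\<lambda>\<omega>. u \<omega> + s *\<^sub>R (v \<omega> - u \<omega>)) \<in> L2 M I"
    using s by (intro L2_add_scaled[OF L(1) L2_diff[OF L(2) L(1)]]) auto
  have in\<Gamma>: "AE \<omega> in M. u \<omega> + s *\<^sub>R (v \<omega> - u \<omega>) \<in> \<Gamma> \<omega>"
    using \<Gamma> AE_space
  proof eventually_elim
    case (elim \<omega>)
    then have "(1 - s) *\<^sub>R u \<omega> + s *\<^sub>R v \<omega> \<in> \<Gamma> \<omega>"
      using s by (intro convexD[OF co]) auto
    then show ?case
      by (simp add: algebra_simps)
  qed
  have "(\<lambda>\<omega>. u' \<omega> + s *\<^sub>R (v' \<omega> - u' \<omega>)) \<in> G \<rightarrow>\<^sub>M coord_borel I"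
    using uv(1,3) by (auto simp: measurable_coord_borel_iff
        intro!: subspace_add subspace_scale subspace_diff subspace_coord_space)
  moreover have "AE \<omega> in M. u \<omega> + s *\<^sub>R (v \<omega> - u \<omega>) = u' \<omega> + s *\<^sub>R (v' \<omega> - u' \<omega>)"
    using uv(2,4) by eventually_elim simp
  ultimately have "(\<lambda>\<omega>. u \<omega> + s *\<^sub>R (v \<omega> - u \<omega>)) \<in> controls_me M I G"
    by (rule controls_meI[OF inL2])
  then show ?thesis
    using inL2 in\<Gamma> by (simp add: controls_as_def)
qed

theorem theorem2p3:
  fixes M :: "'a measure" and T :: nat
    and IW IX :: "nat \<Rightarrow> 'n::finite set"
    and IU :: "nat \<Rightarrow> 'm::finite set"
    and IY :: "nat \<Rightarrow> 'k::finite set"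
    and w :: "nat \<Rightarrow> 'a \<Rightarrow> real ^ 'n"
    and h :: "nat \<Rightarrow> (nat \<Rightarrow> real ^ 'n) \<Rightarrow> real ^ 'k"
    and y :: "nat \<Rightarrow> 'a \<Rightarrow> real ^ 'k"
    and f :: "nat \<Rightarrow> real ^ 'n \<Rightarrow> real ^ 'm \<Rightarrow> real ^ 'n \<Rightarrow> real ^ 'n"
    and L :: "nat \<Rightarrow> real ^ 'n \<Rightarrow> real ^ 'm \<Rightarrow> real ^ 'n \<Rightarrow> real"
    and K :: "real ^ 'n \<Rightarrow> real"
    and \<Gamma> :: "nat \<Rightarrow> 'a \<Rightarrow> (real ^ 'm) set"
    and u :: "nat \<Rightarrow> 'a \<Rightarrow> real ^ 'm"
    and x :: "nat \<Rightarrow> 'a \<Rightarrow> real ^ 'n"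
  assumes "prob_space M" and "1 \<le> T" and "IW 0 = IX 0"
    and noise: "\<And>t. t \<le> T \<Longrightarrow> w t \<in> M \<rightarrow>\<^sub>M coord_borel (IW t)"
    and obs_map: "\<And>t. t \<le> T \<Longrightarrow> h t \<in> (\<Pi>\<^sub>M s\<in>{..T}. coord_borel (IW s)) \<rightarrow>\<^sub>M coord_borel (IY t)"
    and obs_rv: "\<And>t. t \<le> T \<Longrightarrow> y t \<in> M \<rightarrow>\<^sub>M coord_borel (IY t)"
    and obs: "\<And>t. t \<le> T \<Longrightarrow> AE \<omega> in M. y t \<omega> = h t (\<lambda>s\<in>{..T}. w s \<omega>)"
    and dynamics_range: "\<And>t a b c. t < T \<Longrightarrow> a \<in> coord_space (IX t) \<Longrightarrow> b \<in> coord_space (IU t)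
          \<Longrightarrow> c \<in> coord_space (IW (Suc t)) \<Longrightarrow> f t a b c \<in> coord_space (IX (Suc t))"
    and \<Gamma>_range: "\<And>t \<omega>. t < T \<Longrightarrow> \<omega> \<in> space M \<Longrightarrow> \<Gamma> t \<omega> \<subseteq> coord_space (IU t)"
    and \<Gamma>_closed_convex: "\<And>t \<omega>. t < T \<Longrightarrow> \<omega> \<in> space M \<Longrightarrow> closed (\<Gamma> t \<omega>) \<and> convex (\<Gamma> t \<omega>)"
    and f_C1: "\<And>t c. t < T \<Longrightarrow> c \<in> coord_space (IW (Suc t)) \<Longrightarrow>
          C1_on (coord_space (IX t) \<times> coord_space (IU t)) (\<lambda>(a, b). f t a b c)"
    and L_C1: "\<And>t c. t < T \<Longrightarrow> c \<in> coord_space (IW (Suc t)) \<Longrightarrow>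
          C1_on (coord_space (IX t) \<times> coord_space (IU t)) (\<lambda>(a, b). L t a b c)"
    and K_C1: "C1_on (coord_space (IX T)) K"
    and L_normal: "\<And>t. t < T \<Longrightarrow>
          normal_integrand (coord_borel (IW (Suc t))) (coord_space (IX t) \<times> coord_space (IU t))
            (\<lambda>c (a, b). L t a b c)"
    and f_normal: "\<And>t i. t < T \<Longrightarrow> i \<in> IX (Suc t) \<Longrightarrow>
          normal_integrand (coord_borel (IW (Suc t))) (coord_space (IX t) \<times> coord_space (IU t))
            (\<lambda>c (a, b). f t a b c $ i)"
    and sq_int: "square_integrable_derivatives M T IX IU w f L K"
    and G_le_F: "\<And>t. t \<le> T \<Longrightarrow> sets (obs_algebra M y t) \<subseteq> sets (noise_algebra M w t)"
    and \<Gamma>_measurable: "\<And>t. t < T \<Longrightarrow> measurable_setmap (obs_algebra M y t) (\<Gamma> t)"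
    and sol: "is_solution M T IX IU w f L K (obs_algebra M y) \<Gamma> u x"
  shows "\<exists>lam :: nat \<Rightarrow> 'a \<Rightarrow> real ^ 'n.
     (\<forall>t\<le>T. lam t \<in> M \<rightarrow>\<^sub>M coord_borel (IX t)) \<and>
     (AE \<omega> in M. x 0 \<omega> = w 0 \<omega>) \<and>
     (AE \<omega> in M. lam T \<omega> = deriv_T (coord_space (IX T)) K (x T \<omega>) 1) \<and>
     (\<forall>t<T.
        (AE \<omega> in M. x (Suc t) \<omega> = f t (x t \<omega>) (u t \<omega>) (w (Suc t) \<omega>)) \<and>
        (AE \<omega> in M. lam t \<omega> =
            deriv_x_T (IX t) (L t) (x t \<omega>) (u t \<omega>) (w (Suc t) \<omega>) 1
            + deriv_x_T (IX t) (f t) (x t \<omega>) (u t \<omega>) (w (Suc t) \<omega>) (lam (Suc t) \<omega>)) \<and>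
        (\<lambda>\<omega>. - vec_cond_exp M (obs_algebra M y t) (IU t)
                 (\<lambda>\<omega>'. deriv_u_T (IU t) (L t) (x t \<omega>') (u t \<omega>') (w (Suc t) \<omega>') 1
                       + deriv_u_T (IU t) (f t) (x t \<omega>') (u t \<omega>') (w (Suc t) \<omega>') (lam (Suc t) \<omega>')) \<omega>)
          \<in> subdiff_indicator M (IU t) (controls_as M (IU t) (\<Gamma> t)) (u t))"
proof -
  interpret prob_space M by fact
  let ?G = "\<lambda>t. obs_algebra M y t"
  let ?U = "\<lambda>t. controls_as M (IU t) (\<Gamma> t) \<inter> controls_me M (IU t) (?G t)"
  \<comment> \<open>\<open>X v\<close> satisfies the dynamics at every outcome, whereas
    \<open>x\<close> does so only almost surely. Pathwise calculus is done along \<open>X u\<close>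
    and transferred to \<open>x\<close> by \<open>x_eq\<close>.\<close>
  define X where "X v \<omega> t = state f (\<lambda>s. v s \<omega>) (\<lambda>s. w s \<omega>) t" for v :: "nat \<Rightarrow> 'a \<Rightarrow> real ^ 'm" and \<omega> t
  define R where "R v \<omega> = reduced_cost T f L K (\<lambda>s. v s \<omega>) (\<lambda>s. w s \<omega>)" for v :: "nat \<Rightarrow> 'a \<Rightarrow> real ^ 'm" and \<omega>
  define R' where "R' v t \<omega> = deriv_T (coord_space (IU t))
      (\<lambda>b. reduced_cost T f L K ((\<lambda>s. v s \<omega>)(t := b)) (\<lambda>s. w s \<omega>)) (v t \<omega>) 1"
    for v :: "nat \<Rightarrow> 'a \<Rightarrow> real ^ 'm" and t \<omega>
  define lam where "lam t \<omega> = costate T IX f L K (\<lambda>s. u s \<omega>) (\<lambda>s. w s \<omega>) t" for t \<omega>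
  have adm: "admissible M T IX IU w f ?G \<Gamma> u x"
    and opt: "\<And>u' x'. admissible M T IX IU w f ?G \<Gamma> u' x' \<Longrightarrow>
        expected_cost M T w L K u x \<le> expected_cost M T w L K u' x'"
    using sol unfolding is_solution_def by blast+
  have x_meas: "\<And>t. t \<le> T \<Longrightarrow> x t \<in> M \<rightarrow>\<^sub>M coord_borel (IX t)"
    and x0: "AE \<omega> in M. x 0 \<omega> = w 0 \<omega>"
    and xS: "\<And>t. t < T \<Longrightarrow> AE \<omega> in M. x (Suc t) \<omega> = f t (x t \<omega>) (u t \<omega>) (w (Suc t) \<omega>)"
    and u_adm: "\<And>t. t < T \<Longrightarrow> u t \<in> ?U t"
    using adm unfolding admissible_def by blast+
  have u_L2: "u t \<in> L2 M (IU t)" if "t < T" for t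
    using u_adm[OF that] unfolding controls_as_def by blast

  \<comment> \<open>Integrability and measurability along the trajectories\<close>
  note sq = sq_int[unfolded square_integrable_derivatives_def Let_def, THEN spec, THEN mp]
  have R_int: "integrable M (R v)" if "\<forall>t<T. v t \<in> L2 M (IU t)" for v
    using sq[OF that] unfolding R_def[abs_def] by (elim conjE)
  have R'_L2: "R' v t \<in> L2 M (IU t)" if "\<forall>t<T. v t \<in> L2 M (IU t)" "t < T" for v t
    using sq[OF that(1)] that(2) unfolding R'_def[abs_def] by simp
  have lam_meas: "lam t \<in> M \<rightarrow>\<^sub>M coord_borel (IX t)" if "t \<le> T" for t
  proof -
    have "\<forall>t<T. u t \<in> L2 M (IU t)"
      using u_L2 by blast
    from sq[OF this] that have "lam t \<in> L2 M (IX t)"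
      unfolding lam_def[abs_def] by simp
    then show ?thesis
      by (simp add: L2_def)
  qed
  have w_mem: "w t \<omega> \<in> coord_space (IW t)" if "t \<le> T" "\<omega> \<in> space M" for t \<omega>
    using noise[OF that(1)] that(2) by (simp add: measurable_coord_borel_iff)
  have R_C1: "C1_on (coord_space (IU t)) (\<lambda>b. reduced_cost T f L K ((\<lambda>s. u s \<omega>)(t := b)) (\<lambda>s. w s \<omega>))"
    and R'_eq: "R' u t \<omega> =
      deriv_u_T (IU t) (L t) (X u \<omega> t) (u t \<omega>) (w (Suc t) \<omega>) 1
      + deriv_u_T (IU t) (f t) (X u \<omega> t) (u t \<omega>) (w (Suc t) \<omega>) (lam (Suc t) \<omega>)"
    if t: "t < T" and \<omega>: "\<omega> \<in> space M" for t \<omega>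
    using reduced_cost_C1[where u = "\<lambda>s. u s \<omega>" and w = "\<lambda>s. w s \<omega>" and IU = IU, OF \<open>IW 0 = IX 0\<close>
        L2_D(2)[OF u_L2 \<omega>] w_mem[OF _ \<omega>] dynamics_range f_C1 L_C1 K_C1 t]
    by (simp_all add: R'_def X_def lam_def)
  have X_meas: "(\<lambda>\<omega>. X v \<omega> t) \<in> M \<rightarrow>\<^sub>M coord_borel (IX t)"
    if v: "\<forall>t<T. v t \<in> L2 M (IU t)" and "t \<le> T" for v t
    using \<open>t \<le> T\<close>
  proof (induction t)
    case 0
    then show ?case
      using noise[of 0] \<open>IW 0 = IX 0\<close> by (simp add: X_def)
  next
    case (Suc t)
    then have t: "t < T" "t \<le> T"
      by auto
    have "v t \<in> M \<rightarrow>\<^sub>M coord_borel (IU t)"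
      using v t by (simp add: L2_def)
    from measurable_stage_dynamics[OF f_normal[OF t(1)] dynamics_range[OF t(1)] Suc.IH[OF t(2)] this noise[OF Suc.prems]]
    show ?case
      by (simp add: X_def)
  qed
  have x_eq: "AE \<omega> in M. x t \<omega> = X u \<omega> t" if "t \<le> T" for t
    using that
  proof (induction t)
    case 0
    then show ?case
      using x0 by (simp add: X_def)
  next
    case (Suc t)
    then have "AE \<omega> in M. x t \<omega> = X u \<omega> t" "AE \<omega> in M. x (Suc t) \<omega> = f t (x t \<omega>) (u t \<omega>) (w (Suc t) \<omega>)"
      using xS by simp_all
    then show ?case
      by eventually_elim (simp add: X_def)
  qed
  \<comment> \<open>Replacing \<open>x\<close> by \<open>X u\<close> under the integral needs
    measurability of both integrands besides their almost sure equality; here the one along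
    \<open>x\<close> is treated.\<close>
  have path_cost_meas: "(\<lambda>\<omega>. path_cost T L K (\<lambda>t. z t \<omega>) (\<lambda>t. u t \<omega>) (\<lambda>t. w t \<omega>)) \<in> borel_measurable M"
    if z: "\<And>t. t \<le> T \<Longrightarrow> z t \<in> M \<rightarrow>\<^sub>M coord_borel (IX t)" for z
    unfolding path_cost_def
  proof (intro borel_measurable_add borel_measurable_sum)
    fix t assume "t \<in> {..<T}"
    then have t: "t < T" "t \<le> T" "Suc t \<le> T"
      by auto
    have "u t \<in> M \<rightarrow>\<^sub>M coord_borel (IU t)"
      using u_L2[OF t(1)] by (simp add: L2_def)
    from measurable_stage_cost[OF L_normal[OF t(1)] z[OF t(2)] this noise[OF t(3)]]
    show "(\<lambda>\<omega>. L t (z t \<omega>) (u t \<omega>) (w (Suc t) \<omega>)) \<in> borel_measurable M" .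
  next
    obtain D where "\<And>a. a \<in> coord_space (IX T) \<Longrightarrow> (K has_derivative blinfun_apply (D a)) (at a within coord_space (IX T))"
      using K_C1 unfolding C1_on_def by blast
    then have "continuous_on (coord_space (IX T)) K"
      by (meson continuous_on_eq_continuous_within has_derivative_continuous)
    from measurable_compose[OF z[OF order_refl] borel_measurable_continuous_on_restrict[OF this]]
    show "(\<lambda>\<omega>. K (z T \<omega>)) \<in> borel_measurable M" .
  qed

  \<comment> \<open>Optimality in terms of the controls alone\<close>
  have u_all: "\<forall>t<T. u t \<in> L2 M (IU t)"
    using u_L2 by blast
  have cost_u: "expected_cost M T w L K u x = (\<integral>\<omega>. R u \<omega> \<partial>M)"
    unfolding expected_cost_def
  proof (rule integral_cong_AE)
    have "AE \<omega> in M. \<forall>t\<in>{..T}. x t \<omega> = X u \<omega> t"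
      using x_eq by (intro AE_finite_allI) auto
    then show "AE \<omega> in M. path_cost T L K (\<lambda>t. x t \<omega>) (\<lambda>t. u t \<omega>) (\<lambda>t. w t \<omega>) = R u \<omega>"
      by eventually_elim (simp add: R_def reduced_cost_def path_cost_def X_def)
    show "R u \<in> borel_measurable M"
      by (rule borel_measurable_integrable[OF R_int[OF u_all]])
  qed (rule path_cost_meas[OF x_meas])
  have opt_R: "(\<integral>\<omega>. R u \<omega> \<partial>M) \<le> (\<integral>\<omega>. R v \<omega> \<partial>M)" if v: "\<And>t. t < T \<Longrightarrow> v t \<in> ?U t" for v
  proof -
    have "\<forall>t<T. v t \<in> L2 M (IU t)"
      using v unfolding controls_as_def by blast
    \<comment> \<open>Every control in the constraint set becomes admissible together with the
      trajectory \<open>X v\<close> that it generates, so the state can be eliminated from the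
      minimisation.\<close>
    then have "admissible M T IX IU w f ?G \<Gamma> v (\<lambda>t \<omega>. X v \<omega> t)"
      using v X_meas unfolding admissible_def by (simp add: X_def)
    from opt[OF this, unfolded cost_u] show ?thesis
      by (simp add: expected_cost_def R_def[abs_def] reduced_cost_def X_def)
  qed

  \<comment> \<open>The stationarity condition at one time\<close>
  have "(\<lambda>\<omega>. - vec_cond_exp M (?G t) (IU t)
           (\<lambda>\<omega>'. deriv_u_T (IU t) (L t) (x t \<omega>') (u t \<omega>') (w (Suc t) \<omega>') 1
                 + deriv_u_T (IU t) (f t) (x t \<omega>') (u t \<omega>') (w (Suc t) \<omega>') (lam (Suc t) \<omega>')) \<omega>)
      \<in> subdiff_indicator M (IU t) (controls_as M (IU t) (\<Gamma> t)) (u t)" if t: "t < T" for t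
  proof -
    have t': "t \<le> T" "Suc t \<le> T"
      using t by auto
    have sub: "subalgebra M (?G t)"
      unfolding obs_algebra_def
      using obs_rv[OF t'(1)] by (intro subalgebra_vimage_algebra) (simp add: measurable_coord_borel_iff)
    define g where "g \<omega> = deriv_u_T (IU t) (L t) (x t \<omega>) (u t \<omega>) (w (Suc t) \<omega>) 1
                 + deriv_u_T (IU t) (f t) (x t \<omega>) (u t \<omega>) (w (Suc t) \<omega>) (lam (Suc t) \<omega>)" for \<omega>
    have u_meas: "u t \<in> M \<rightarrow>\<^sub>M coord_borel (IU t)"
      using u_L2[OF t] by (simp add: L2_def)
    have x_mem: "x t \<omega> \<in> coord_space (IX t)" if "\<omega> \<in> space M" for \<omega>
      using x_meas[OF t'(1)] that by (simp add: measurable_coord_borel_iff)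
    \<comment> \<open>Square integrability is known for \<open>R' u t\<close>, taken along
      \<open>X u\<close>, while \<open>g\<close> is taken along \<open>x\<close>. Measurability of
      \<open>g\<close> is therefore shown directly, and its square integrability then follows from
      the almost sure equality \<open>g_eq\<close>.\<close>
    have "(\<lambda>\<omega>. deriv_u_T (IU t) (L t) (x t \<omega>) (u t \<omega>) (w (Suc t) \<omega>) 1) \<in> M \<rightarrow>\<^sub>M coord_borel (IU t)"
      unfolding deriv_u_T_def
    proof (rule measurable_deriv_T[OF u_meas])
      show "C1_on (coord_space (IU t)) (\<lambda>b. L t (x t \<omega>) b (w (Suc t) \<omega>))" if "\<omega> \<in> space M" for \<omega>
        by (rule C1_on_Pair2[OF L_C1[OF t w_mem[OF t'(2) that]] x_mem[OF that]])
      show "(\<lambda>\<omega>. inner 1 (L t (x t \<omega>) (v \<omega>) (w (Suc t) \<omega>))) \<in> borel_measurable M"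
        if "v \<in> M \<rightarrow>\<^sub>M coord_borel (IU t)" for v
        using measurable_stage_cost[OF L_normal[OF t] x_meas[OF t'(1)] that noise[OF t'(2)]] by simp
    qed
    moreover have "(\<lambda>\<omega>. deriv_u_T (IU t) (f t) (x t \<omega>) (u t \<omega>) (w (Suc t) \<omega>) (lam (Suc t) \<omega>))
        \<in> M \<rightarrow>\<^sub>M coord_borel (IU t)"
      unfolding deriv_u_T_def
    proof (rule measurable_deriv_T[OF u_meas])
      show "C1_on (coord_space (IU t)) (\<lambda>b. f t (x t \<omega>) b (w (Suc t) \<omega>))" if "\<omega> \<in> space M" for \<omega>
        by (rule C1_on_Pair2[OF f_C1[OF t w_mem[OF t'(2) that]] x_mem[OF that]])
      show "(\<lambda>\<omega>. inner (lam (Suc t) \<omega>) (f t (x t \<omega>) (v \<omega>) (w (Suc t) \<omega>))) \<in> borel_measurable M"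
        if v: "v \<in> M \<rightarrow>\<^sub>M coord_borel (IU t)" for v
        using measurable_stage_dynamics[OF f_normal[OF t] dynamics_range[OF t] x_meas[OF t'(1)] v noise[OF t'(2)]]
          lam_meas[OF t'(2)]
        by (auto simp: measurable_coord_borel_iff)
    qed
    ultimately have g_meas: "g \<in> M \<rightarrow>\<^sub>M coord_borel (IU t)"
      unfolding g_def[abs_def]
      by (auto simp: measurable_coord_borel_iff subspace_add[OF subspace_coord_space])
    have g_eq: "AE \<omega> in M. g \<omega> = R' u t \<omega>"
      using x_eq[OF t'(1)] AE_space
      by eventually_elim (simp add: g_def R'_eq[OF t])
    have R'u: "R' u t \<in> L2 M (IU t)"
      by (rule R'_L2[OF u_all t])
    have g_L2: "g \<in> L2 M (IU t)"
      by (rule L2_I[OF g_meas L2_D(3)[OF R'u]]) (use g_eq in \<open>eventually_elim, simp\<close>)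
    have first_order: "0 \<le> (\<integral>\<omega>. inner (g \<omega>) (v \<omega> - u t \<omega>) \<partial>M)" if v: "v \<in> ?U t" for v
    proof -
      define b where "b \<omega> = v \<omega> - u t \<omega>" for \<omega>
      have v_L2: "v \<in> L2 M (IU t)"
        using v unfolding controls_as_def by blast
      have b: "b \<in> L2 M (IU t)"
        unfolding b_def[abs_def] by (rule L2_diff[OF v_L2 u_L2[OF t]])
      \<comment> \<open>Only the control at time \<open>t\<close> is moved, in direction
        \<open>b\<close>. Constant \<open>\<sigma>\<close> gives the competitors, random
        \<open>\<sigma>\<close> the integrability needed for domination.\<close>
      define P where "P \<sigma> = u(t := \<lambda>\<omega>. u t \<omega> + \<sigma> \<omega> *\<^sub>R b \<omega>)" for \<sigma> :: "'a \<Rightarrow> real"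
      have P_L2: "\<forall>s<T. P \<sigma> s \<in> L2 M (IU s)"
        if "\<sigma> \<in> borel_measurable M" "\<And>\<omega>. \<sigma> \<omega> \<in> {0..1}" for \<sigma>
        using L2_add_scaled[OF u_L2[OF t] b that(1)] that(2) u_L2 by (auto simp: P_def)
      have P_upd: "(\<lambda>s. P \<sigma> s \<omega>) = (\<lambda>s. u s \<omega>)(t := u t \<omega> + \<sigma> \<omega> *\<^sub>R b \<omega>)" for \<sigma> \<omega>
        by (auto simp: P_def)
      define F where "F \<omega> s = reduced_cost T f L K ((\<lambda>s. u s \<omega>)(t := u t \<omega> + s *\<^sub>R b \<omega>)) (\<lambda>s. w s \<omega>)" for \<omega> s
      define F' where "F' \<omega> s = inner (deriv_T (coord_space (IU t))
          (\<lambda>b. reduced_cost T f L K ((\<lambda>s. u s \<omega>)(t := b)) (\<lambda>s. w s \<omega>)) (u t \<omega> + s *\<^sub>R b \<omega>) 1) (b \<omega>)" for \<omega> s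
      have F_eq: "F \<omega> s = R (P (\<lambda>_. s)) \<omega>" for \<omega> s
        by (simp add: F_def R_def P_upd)
      have F'_eq: "F' \<omega> (\<sigma> \<omega>) = inner (R' (P \<sigma>) t \<omega>) (b \<omega>)" for \<omega> \<sigma>
        by (simp add: F'_def R'_def P_upd) (simp add: P_def)
      have P0: "P (\<lambda>_. 0) = u"
        by (simp add: P_def)
      have "0 \<le> (\<integral>\<omega>. F' \<omega> 0 \<partial>M)"
      proof (rule integral_derivative_nonneg[where F = F and F' = F'])
        show "finite_measure M"
          by unfold_locales
        show "(F \<omega> has_real_derivative F' \<omega> s) (at s)" if "\<omega> \<in> space M" for \<omega> s
          unfolding F_def[abs_def] F'_def
          by (rule C1_on_line(1)[OF subspace_coord_space R_C1[OF t that] L2_D(2)[OF u_L2[OF t] that] L2_D(2)[OF b that]])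
        show "continuous_on UNIV (F' \<omega>)" if "\<omega> \<in> space M" for \<omega>
          unfolding F'_def[abs_def]
          by (rule C1_on_line(2)[OF subspace_coord_space R_C1[OF t that] L2_D(2)[OF u_L2[OF t] that] L2_D(2)[OF b that]])
        show "integrable M (\<lambda>\<omega>. F' \<omega> (\<sigma> \<omega>))"
          if "\<sigma> \<in> borel_measurable M" "\<And>\<omega>. \<sigma> \<omega> \<in> {0..1}" for \<sigma>
          \<comment> \<open>The square integrability hypothesis holds along every square integrable
            control, so it applies to \<open>P \<sigma>\<close> even though that control need not be
            observable.\<close>
          unfolding F'_eq by (rule L2_integrable_inner[OF R'_L2[OF P_L2[OF that] t] b])
        show "integrable M (\<lambda>\<omega>. F \<omega> s)" if "s \<in> {0..1}" for s
          unfolding F_eq using that by (intro R_int P_L2) auto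
        show "(\<integral>\<omega>. F \<omega> 0 \<partial>M) \<le> (\<integral>\<omega>. F \<omega> s \<partial>M)" if "s \<in> {0..1}" for s
          unfolding F_eq P0
        proof (rule opt_R)
          fix r assume r: "r < T"
          show "P (\<lambda>_. s) r \<in> ?U r"
          proof (cases "r = t")
            case True
            then show ?thesis
              using controls_segment[OF u_adm[OF t] v _ that] \<Gamma>_closed_convex[OF t] by (simp add: P_def b_def)
          qed (use u_adm[OF r] in \<open>simp add: P_def\<close>)
        qed
      qed
      also have "(\<integral>\<omega>. F' \<omega> 0 \<partial>M) = (\<integral>\<omega>. inner (R' u t \<omega>) (b \<omega>) \<partial>M)"
        using F'_eq[of _ "\<lambda>_. 0"] by (simp add: P0)
      also have "\<dots> = (\<integral>\<omega>. inner (g \<omega>) (b \<omega>) \<partial>M)"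
      proof (rule integral_cong_AE)
        show "AE \<omega> in M. inner (R' u t \<omega>) (b \<omega>) = inner (g \<omega>) (b \<omega>)"
          using g_eq by eventually_elim simp
      qed (use L2_D(1)[OF g_L2] L2_D(1)[OF R'u] L2_D(1)[OF b] in measurable)
      finally show ?thesis
        by (simp add: b_def)
    qed
    let ?r = "vec_cond_exp M (?G t) (IU t) g"
    have r_L2: "?r \<in> L2 M (IU t)"
      by (rule vec_cond_exp_L2[OF \<open>prob_space M\<close> sub g_L2])
    have "0 \<le> (\<integral>\<omega>. inner (?r \<omega>) (v \<omega> - u t \<omega>) \<partial>M)" if v: "v \<in> ?U t" for v
    proof -
      \<comment> \<open>Since the direction \<open>v - u t\<close> is observable, pairing it with
        \<open>g\<close> or with its conditional expectation gives the same integral.\<close>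
      have "(\<lambda>\<omega>. v \<omega> - u t \<omega>) \<in> controls_me M (IU t) (?G t)"
        using v u_adm[OF t] by (intro controls_me_diff) auto
      from integral_inner_vec_cond_exp_controls_me[OF \<open>prob_space M\<close> sub g_L2 this] first_order[OF v]
      show ?thesis
        by simp
    qed
    from variational_inequality_pointwise[OF \<open>prob_space M\<close> sub \<Gamma>_measurable[OF t] _ _ \<Gamma>_range[OF t] u_adm[OF t]
        r_L2 measurable_vec_cond_exp this] \<Gamma>_closed_convex[OF t]
    have pointwise: "AE \<omega> in M. \<forall>b\<in>\<Gamma> t \<omega>. 0 \<le> inner (?r \<omega>) (b - u t \<omega>)"
      by blast
    \<comment> \<open>Pointwise normality compares with all points of
      \<open>\<Gamma> t \<omega>\<close>, so \<open>v\<close> is now subject to the almost sure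
      constraint only.\<close>
    have "(\<integral>\<omega>. inner (- ?r \<omega>) (v \<omega> - u t \<omega>) \<partial>M) \<le> 0" if "v \<in> controls_as M (IU t) (\<Gamma> t)" for v
    proof -
      have "AE \<omega> in M. v \<omega> \<in> \<Gamma> t \<omega>"
        using that unfolding controls_as_def by blast
      with pointwise have "AE \<omega> in M. 0 \<le> inner (?r \<omega>) (v \<omega> - u t \<omega>)"
        by eventually_elim blast
      then show ?thesis
        using integral_nonneg_AE by fastforce
    qed
    moreover have "(\<lambda>\<omega>. - ?r \<omega>) \<in> L2 M (IU t)"
      using r_L2 by (auto simp: L2_def measurable_coord_borel_iff subspace_neg[OF subspace_coord_space])
    ultimately have "(\<lambda>\<omega>. - ?r \<omega>) \<in> subdiff_indicator M (IU t) (controls_as M (IU t) (\<Gamma> t)) (u t)"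
      unfolding subdiff_indicator_def by blast
    then show ?thesis
      by (simp only: g_def[abs_def])
  qed

  \<comment> \<open>The co-state equations\<close>
  moreover have "AE \<omega> in M. lam T \<omega> = deriv_T (coord_space (IX T)) K (x T \<omega>) 1"
    using x_eq[OF order_refl] by eventually_elim (simp add: lam_def costate_def X_def)
  moreover have "AE \<omega> in M. lam t \<omega> =
      deriv_x_T (IX t) (L t) (x t \<omega>) (u t \<omega>) (w (Suc t) \<omega>) 1
      + deriv_x_T (IX t) (f t) (x t \<omega>) (u t \<omega>) (w (Suc t) \<omega>) (lam (Suc t) \<omega>)" if "t < T" for t
  proof -
    \<comment> \<open>The co-state recursion counts remaining steps. Writing \<open>T - t\<close> as
      a successor unfolds it once, and the time read off inside is again \<open>t\<close>.\<close>
    have k: "T - t = Suc (T - Suc t)" "T - Suc (T - Suc t) = t"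
      using that by auto
    show ?thesis
      using x_eq[OF less_imp_le[OF that]]
      by eventually_elim (simp add: lam_def costate_def X_def k Let_def)
  qed
  ultimately show ?thesis
    using lam_meas x0 xS by (intro exI[of _ lam]) blast
qed

end
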